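(* (i) There exists a positive integer $s$ such that for all graphs $G,H$ having the $s$-extension property, if each of the sentences $\varphi^1_C,\varphi^2_C,\varphi^3_C,\varphi^1_I,\varphi^2_I,\varphi^3_I$ does not differ between $G$ and $H$ (that is, it is true on both or false on both), then no sentence $\varphi\in\mathcal{E}_1^2$ differs between $G$ and $H$. (ii) For every positive integer $s$ and every $$\varphi\in\{\varphi^1_C,\ \neg\varphi^1_C\wedge\neg\varphi^2_C\wedge\varphi^3_C,\ \neg\varphi^1_C\wedge\neg\varphi^2_C\wedge\neg\varphi^3_C,\ \varphi^2_C\wedge\varphi^3_C,\ \varphi^2_C\wedge\neg\varphi^3_C\},$$ there exists a graph $G$ with the $s$-extension property such that $G\models\varphi$; and the same holds with $\varphi^1_C,\varphi^2_C,\varphi^3_C$ replaced by $\varphi^1_I,\varphi^2_I,\varphi^3_I$ respectively.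
   Context: Graphs are finite undirected simple graphs; sentences use relations $\sim$ (adjacency) and $=$. A graph has the $s$-extension property if for every set $S$ of $s$ distinct vertices and every subset $T\subseteq S$ (possibly empty) there is a vertex $z\notin S$ adjacent to every vertex of $T$ and non-adjacent to every vertex of $S\setminus T$. $\mathcal{E}_1^2$ is the class of sentences $\exists X\,\phi(X)$ with a single monadic variable $X$ (ranging over vertex subsets) and $\phi(X)$ a first order sentence in $\sim,=,X$ of quantifier depth 2. Define formulas of a set variable $X$: $\mathrm{cl}(X)$: any two distinct vertices of $X$ are adjacent; $\max\mathrm{cl}(X)$: $\mathrm{cl}(X)$ holds and there is no vertex outside $X$ adjacent to all vertices of $X$; $\varphi_C(X)$: there is a vertex outside $X$ adjacent to no vertex of $X$; $\mathrm{ind}(X)$: no two vertices of $X$ are adjacent; $\max\mathrm{ind}(X)$: $\mathrm{ind}(X)$ holds and there is no vertex outside $X$ adjacent to no vertex of $X$; $\varphi_I(X)$: there is a vertex outside $X$ adjacent to every vertex of $X$. Then $\varphi^1_C=\forall X[\mathrm{cl}(X)\to\varphi_C(X)]$, $\varphi^2_C=\forall X[\max\mathrm{cl}(X)\to\neg\varphi_C(X)]$, $\varphi^3_C=\forall X[(\mathrm{cl}(X)\wedge\neg\varphi_C(X))\to\max\mathrm{cl}(X)]$, and $\varphi^1_I=\forall X[\mathrm{ind}(X)\to\varphi_I(X)]$, $\varphi^2_I=\forall X[\max\mathrm{ind}(X)\to\neg\varphi_I(X)]$, $\varphi^3_I=\forall X[(\mathrm{ind}(X)\wedge\neg\varphi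_I(X))\to\max\mathrm{ind}(X)]$.
   Formalization: The s-extension property additionally requires at least s vertices, since otherwise smaller graphs have it vacuously and (i) fails (e.g. the empty graph and the one-vertex graph); finite graphs are taken with vertices among the natural numbers. *)

theory Defs
  imports Main
begin

section \<open>Finite simple graphs (vertices drawn from nat; every finite graph is isomorphic to one of these)\<close>

record graph =
  verts :: "nat set"
  adj :: "nat \<Rightarrow> nat \<Rightarrow> bool"

definition is_graph :: "graph \<Rightarrow> bool" where
  "is_graph G \<longleftrightarrow> finite (verts G)
     \<and> (\<forall>u v. adj G u v \<longrightarrow> u \<in> verts G \<and> v \<in> verts G)
     \<and> (\<forall>u v. adj G u v \<longrightarrow> adj G v u)
     \<and> (\<forall>u. \<not> adj G u u)"

definition ext_prop :: "nat \<Rightarrow> graph \<Rightarrow> bool" where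
  "ext_prop s G \<longleftrightarrow> s \<le> card (verts G) \<and>
     (\<forall>S T. S \<subseteq> verts G \<longrightarrow> card S = s \<longrightarrow> T \<subseteq> S \<longrightarrow>
        (\<exists>z \<in> verts G. z \<notin> S \<and> (\<forall>t\<in>T. adj G z t) \<and> (\<forall>u\<in>S - T. \<not> adj G z u)))"

datatype fo =
    Adj nat nat
  | Eq nat nat
  | InX nat
  | Neg fo
  | Conj fo fo
  | Ex nat fo

fun fv :: "fo \<Rightarrow> nat set" where
  "fv (Adj x y) = {x, y}"
| "fv (Eq x y) = {x, y}"
| "fv (InX x) = {x}"
| "fv (Neg f) = fv f"
| "fv (Conj f g) = fv f \<union> fv g"
| "fv (Ex x f) = fv f - {x}"

fun qdepth :: "fo \<Rightarrow> nat" where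
  "qdepth (Adj x y) = 0"
| "qdepth (Eq x y) = 0"
| "qdepth (InX x) = 0"
| "qdepth (Neg f) = qdepth f"
| "qdepth (Conj f g) = max (qdepth f) (qdepth g)"
| "qdepth (Ex x f) = Suc (qdepth f)"

fun sat :: "graph \<Rightarrow> nat set \<Rightarrow> (nat \<Rightarrow> nat) \<Rightarrow> fo \<Rightarrow> bool" where
  "sat G X e (Adj x y) = adj G (e x) (e y)"
| "sat G X e (Eq x y) = (e x = e y)"
| "sat G X e (InX x) = (e x \<in> X)"
| "sat G X e (Neg f) = (\<not> sat G X e f)"
| "sat G X e (Conj f g) = (sat G X e f \<and> sat G X e g)"
| "sat G X e (Ex x f) = (\<exists>v \<in> verts G. sat G X (e(x := v)) f)"

text \<open>The class E_1^2: sentences EX X. phi(X), phi first order of quantifier depth (at most) 2.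
  We represent such a sentence by its first-order matrix phi.\<close>
definition E12 :: "fo \<Rightarrow> bool" where
  "E12 \<phi> \<longleftrightarrow> fv \<phi> = {} \<and> qdepth \<phi> \<le> 2"

definition holds_E12 :: "graph \<Rightarrow> fo \<Rightarrow> bool" where
  "holds_E12 G \<phi> \<longleftrightarrow> (\<exists>X \<subseteq> verts G. sat G X (\<lambda>_. 0) \<phi>)"

definition cl :: "graph \<Rightarrow> nat set \<Rightarrow> bool" where
  "cl G X \<longleftrightarrow> (\<forall>x\<in>X. \<forall>y\<in>X. x \<noteq> y \<longrightarrow> adj G x y)"

definition maxcl :: "graph \<Rightarrow> nat set \<Rightarrow> bool" where
  "maxcl G X \<longleftrightarrow> cl G X \<and> \<not> (\<exists>z \<in> verts G - X. \<forall>x\<in>X. adj G z x)"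

definition phiC :: "graph \<Rightarrow> nat set \<Rightarrow> bool" where
  "phiC G X \<longleftrightarrow> (\<exists>z \<in> verts G - X. \<forall>x\<in>X. \<not> adj G z x)"

definition ind :: "graph \<Rightarrow> nat set \<Rightarrow> bool" where
  "ind G X \<longleftrightarrow> (\<forall>x\<in>X. \<forall>y\<in>X. \<not> adj G x y)"

definition maxind :: "graph \<Rightarrow> nat set \<Rightarrow> bool" where
  "maxind G X \<longleftrightarrow> ind G X \<and> \<not> (\<exists>z \<in> verts G - X. \<forall>x\<in>X. \<not> adj G z x)"

definition phiI :: "graph \<Rightarrow> nat set \<Rightarrow> bool" where
  "phiI G X \<longleftrightarrow> (\<exists>z \<in> verts G - X. \<forall>x\<in>X. adj G z x)"

definition phiC1 :: "graph \<Rightarrow> bool" where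
  "phiC1 G \<longleftrightarrow> (\<forall>X \<subseteq> verts G. cl G X \<longrightarrow> phiC G X)"
definition phiC2 :: "graph \<Rightarrow> bool" where
  "phiC2 G \<longleftrightarrow> (\<forall>X \<subseteq> verts G. maxcl G X \<longrightarrow> \<not> phiC G X)"
definition phiC3 :: "graph \<Rightarrow> bool" where
  "phiC3 G \<longleftrightarrow> (\<forall>X \<subseteq> verts G. (cl G X \<and> \<not> phiC G X) \<longrightarrow> maxcl G X)"

definition phiI1 :: "graph \<Rightarrow> bool" where
  "phiI1 G \<longleftrightarrow> (\<forall>X \<subseteq> verts G. ind G X \<longrightarrow> phiI G X)"
definition phiI2 :: "graph \<Rightarrow> bool" where
  "phiI2 G \<longleftrightarrow> (\<forall>X \<subseteq> verts G. maxind G X \<longrightarrow> \<not> phiI G X)"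
definition phiI3 :: "graph \<Rightarrow> bool" where
  "phiI3 G \<longleftrightarrow> (\<forall>X \<subseteq> verts G. (ind G X \<and> \<not> phiI G X) \<longrightarrow> maxind G X)"

end

theory Submission
  imports Defs "HOL-Library.Disjoint_Sets" "HOL-Real_Asymp.Real_Asymp"
begin

text \<open>
  Read adjacency as a two-colouring of the pairs of vertices. A sentence of depth two evaluated on \<open>(G, X)\<close> only
  sees which vertex types occur, where the type of a vertex records its side and the colours it sees inside and
  outside \<open>X\<close>. Under the extension property a set of types that occurs either occurs in every such graph or, up to
  exchanging \<open>X\<close> with its complement, comes from a monochromatic \<open>X\<close>; it is then determined by the colours
  in which some outer vertex sees all of \<open>X\<close>. The six sentences say precisely which sets of outer colours occur
  for cliques and for independent sets, and this gives (i).

  For (ii), replace the vertices of a small graph \<open>Q\<close> by independent classes, take \<open>s + 1\<close> copies, and join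
  different copies generically; a counting argument provides the generic part. A clique of this blow-up is maximal
  iff all its traces on the copies are maximal cliques of \<open>Q\<close>, and some outer vertex misses it iff some trace
  is not totally dominating in \<open>Q\<close>. The five behaviours come from the induced subgraphs of the bull that are a
  single vertex, an edge, a triangle, a path on four vertices, and the bull itself.
\<close>

lemma is_graph_irrefl: "is_graph G \<Longrightarrow> \<not> adj G v v"
  and is_graph_sym: "is_graph G \<Longrightarrow> adj G u v \<longleftrightarrow> adj G v u"
  and is_graph_finite: "is_graph G \<Longrightarrow> finite (verts G)"
  unfolding is_graph_def by blast+

section \<open>Vertex types and sentences of quantifier depth two\<close>

definition colours :: "graph \<Rightarrow> nat set \<Rightarrow> nat \<Rightarrow> bool set" where
  "colours G A v = adj G v ` (A - {v})"

type_synonym vertex_type = "bool \<times> bool set \<times> bool set"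

definition vtype :: "graph \<Rightarrow> nat set \<Rightarrow> nat \<Rightarrow> vertex_type" where
  "vtype G X v = (v \<in> X, colours G X v, colours G (verts G - X) v)"

definition vtypes :: "graph \<Rightarrow> nat set \<Rightarrow> vertex_type set" where
  "vtypes G X = vtype G X ` verts G"

definition vtype_sets :: "graph \<Rightarrow> vertex_type set set" where
  "vtype_sets G = vtypes G ` Pow (verts G)"

lemma mem_colours_iff: "c \<in> colours G A v \<longleftrightarrow> (\<exists>u\<in>A. u \<noteq> v \<and> adj G v u = c)"
  by (auto simp: colours_def)

definition atoms_agree ::
  "graph \<Rightarrow> nat set \<Rightarrow> (nat \<Rightarrow> nat) \<Rightarrow> graph \<Rightarrow> nat set \<Rightarrow> (nat \<Rightarrow> nat) \<Rightarrow> nat set \<Rightarrow> bool" where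
  "atoms_agree G X e H X' e' V \<longleftrightarrow>
     (\<forall>x\<in>V. (e x \<in> X \<longleftrightarrow> e' x \<in> X') \<and>
        (\<forall>y\<in>V. (adj G (e x) (e y) \<longleftrightarrow> adj H (e' x) (e' y)) \<and> (e x = e y \<longleftrightarrow> e' x = e' y)))"

lemma sat_cong_qdepth_0:
  assumes "qdepth f = 0" "atoms_agree G X e H X' e' (fv f)"
  shows "sat G X e f \<longleftrightarrow> sat H X' e' f"
  using assms by (induction f) (auto simp: atoms_agree_def)

lemma atoms_agree_upd:
  assumes "is_graph G" "is_graph H"
    and "e x \<in> X \<longleftrightarrow> e' x \<in> X'" "v \<in> X \<longleftrightarrow> v' \<in> X'" "v = e x \<longleftrightarrow> v' = e' x"
    and "adj G (e x) v \<longleftrightarrow> adj H (e' x) v'"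
  shows "atoms_agree G X (e(y := v)) H X' (e'(y := v')) {x, y}"
  using assms is_graph_irrefl is_graph_sym unfolding atoms_agree_def by (auto 0 3)

lemma vtype_eq_forth:
  assumes G: "is_graph G" and H: "is_graph H" and X: "X' \<subseteq> verts H"
    and u': "u' \<in> verts H" and eq: "vtype G X u = vtype H X' u'" and v: "v \<in> verts G"
  obtains v' where "v' \<in> verts H" "v \<in> X \<longleftrightarrow> v' \<in> X'" "v = u \<longleftrightarrow> v' = u'" "adj G u v \<longleftrightarrow> adj H u' v'"
proof (cases "v = u")
  case True
  then show thesis using that[OF u'] eq is_graph_irrefl[OF G] is_graph_irrefl[OF H] by (simp add: vtype_def)
next
  case False
  let ?A = "if v \<in> X then X else verts G - X" and ?A' = "if v \<in> X then X' else verts H - X'"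
  have "adj G u v \<in> colours G ?A u" using v False by (auto simp: colours_def)
  also have "colours G ?A u = colours H ?A' u'" using eq by (simp add: vtype_def)
  finally obtain v' where v': "v' \<in> ?A'" "v' \<noteq> u'" "adj H u' v' = adj G u v"
    unfolding mem_colours_iff by blast
  then show thesis using that[of v'] X False by (auto split: if_splits)
qed

lemma sat_cong_qdepth_1:
  assumes G: "is_graph G" and H: "is_graph H" and X: "X \<subseteq> verts G" "X' \<subseteq> verts H"
    and "qdepth f \<le> 1" "fv f \<subseteq> {x}" and ex: "e x \<in> verts G" "e' x \<in> verts H"
    and eq: "vtype G X (e x) = vtype H X' (e' x)"
  shows "sat G X e f \<longleftrightarrow> sat H X' e' f"
  using assms(5,6)
proof (induction f)
  case (Ex y g)
  have side: "e x \<in> X \<longleftrightarrow> e' x \<in> X'" using eq by (simp add: vtype_def)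
  have sat_upd: "sat G X (e(y := v)) g \<longleftrightarrow> sat H X' (e'(y := v')) g"
    if "v \<in> X \<longleftrightarrow> v' \<in> X'" "v = e x \<longleftrightarrow> v' = e' x" "adj G (e x) v \<longleftrightarrow> adj H (e' x) v'" for v v'
  proof (rule sat_cong_qdepth_0)
    show "qdepth g = 0" using Ex.prems by simp
    have "atoms_agree G X (e(y := v)) H X' (e'(y := v')) {x, y}"
      by (rule atoms_agree_upd[OF G H]) (use side that in auto)
    moreover have "fv g \<subseteq> {x, y}" using Ex.prems by auto
    ultimately show "atoms_agree G X (e(y := v)) H X' (e'(y := v')) (fv g)"
      unfolding atoms_agree_def by blast
  qed
  show ?case
  proof
    assume "sat G X e (Ex y g)"
    then obtain v where v: "v \<in> verts G" "sat G X (e(y := v)) g" by auto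
    from vtype_eq_forth[OF G H X(2) ex(2) eq v(1)] sat_upd v(2)
    show "sat H X' e' (Ex y g)" by (metis sat.simps(6))
  next
    assume "sat H X' e' (Ex y g)"
    then obtain v' where v': "v' \<in> verts H" "sat H X' (e'(y := v')) g" by auto
    from vtype_eq_forth[OF H G X(1) ex(1) eq[symmetric] v'(1)] sat_upd v'(2)
    show "sat G X e (Ex y g)" by (metis sat.simps(6))
  qed
next
  case (Adj y z)
  then show ?case using is_graph_irrefl[OF G] is_graph_irrefl[OF H] by auto
next
  case (InX y)
  then show ?case using eq by (simp add: vtype_def)
qed auto

lemma sat_cong_qdepth_2:
  assumes G: "is_graph G" and H: "is_graph H" and X: "X \<subseteq> verts G" "X' \<subseteq> verts H"
    and "qdepth f \<le> 2" "fv f = {}" and eq: "vtypes G X = vtypes H X'"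
  shows "sat G X e f \<longleftrightarrow> sat H X' e' f"
  using assms(5,6)
proof (induction f)
  case (Ex y g)
  have "sat G X (e(y := v)) g \<longleftrightarrow> sat H X' (e'(y := v')) g"
    if "v \<in> verts G" "v' \<in> verts H" "vtype G X v = vtype H X' v'" for v v'
    by (rule sat_cong_qdepth_1[OF G H X, where x = y]) (use Ex.prems that in auto)
  moreover have "\<forall>v\<in>verts G. \<exists>v'\<in>verts H. vtype G X v = vtype H X' v'"
    and "\<forall>v'\<in>verts H. \<exists>v\<in>verts G. vtype G X v = vtype H X' v'"
    using eq unfolding vtypes_def by (metis imageE imageI)+
  ultimately show ?case by (auto, blast+)
qed auto

lemma holds_E12_cong_vtype_sets:
  assumes G: "is_graph G" and H: "is_graph H" and \<phi>: "E12 \<phi>" and eq: "vtype_sets G = vtype_sets H"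
  shows "holds_E12 G \<phi> \<longleftrightarrow> holds_E12 H \<phi>"
proof -
  have sat_iff: "sat G X (\<lambda>_. 0) \<phi> \<longleftrightarrow> sat H X' (\<lambda>_. 0) \<phi>"
    if "X \<subseteq> verts G" "X' \<subseteq> verts H" "vtypes G X = vtypes H X'" for X X'
    using sat_cong_qdepth_2[OF G H that(1,2)] \<phi> that(3) by (simp add: E12_def)
  have "\<forall>X\<subseteq>verts G. \<exists>X'\<subseteq>verts H. vtypes G X = vtypes H X'"
    and "\<forall>X'\<subseteq>verts H. \<exists>X\<subseteq>verts G. vtypes G X = vtypes H X'"
    using eq unfolding vtype_sets_def by (metis PowD PowI imageE imageI)+
  then show ?thesis unfolding holds_E12_def by (metis sat_iff)
qed

definition swap_sides :: "vertex_type \<Rightarrow> vertex_type" where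
  "swap_sides = (\<lambda>(b, p, q). (\<not> b, q, p))"

lemma vtypes_Diff:
  assumes "X \<subseteq> verts G"
  shows "vtypes G (verts G - X) = swap_sides ` vtypes G X"
proof -
  have "verts G - (verts G - X) = X" using assms by blast
  then have "vtype G (verts G - X) v = swap_sides (vtype G X v)" if "v \<in> verts G" for v
    using that by (simp add: vtype_def swap_sides_def)
  then show ?thesis unfolding vtypes_def image_image by (rule image_cong[OF refl])
qed

section \<open>Monochromatic sets and their outer colours\<close>

definition monochromatic :: "graph \<Rightarrow> bool \<Rightarrow> nat set \<Rightarrow> bool" where
  "monochromatic G c X \<longleftrightarrow> (\<forall>x\<in>X. \<forall>y\<in>X. x \<noteq> y \<longrightarrow> (adj G x y \<longleftrightarrow> c))"

definition outer_colours :: "graph \<Rightarrow> nat set \<Rightarrow> bool set" where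
  "outer_colours G X = {c. \<exists>z\<in>verts G - X. \<forall>x\<in>X. adj G z x \<longleftrightarrow> c}"

definition mono_outer_colours :: "graph \<Rightarrow> bool \<Rightarrow> bool set set" where
  "mono_outer_colours G c = outer_colours G ` {X. X \<subseteq> verts G \<and> monochromatic G c X}"

lemma cl_iff_monochromatic: "cl G X \<longleftrightarrow> monochromatic G True X"
  by (simp add: cl_def monochromatic_def)

lemma ind_iff_monochromatic: "is_graph G \<Longrightarrow> ind G X \<longleftrightarrow> monochromatic G False X"
  using is_graph_irrefl unfolding ind_def monochromatic_def by metis

lemma phiC_iff_outer_colours: "phiC G X \<longleftrightarrow> False \<in> outer_colours G X"
  by (simp add: phiC_def outer_colours_def)

lemma phiI_iff_outer_colours: "phiI G X \<longleftrightarrow> True \<in> outer_colours G X"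
  by (simp add: phiI_def outer_colours_def)

lemma maxcl_iff_not_phiI: "maxcl G X \<longleftrightarrow> cl G X \<and> \<not> phiI G X"
  by (simp add: maxcl_def phiI_def)

lemma maxind_iff_not_phiC: "maxind G X \<longleftrightarrow> ind G X \<and> \<not> phiC G X"
  by (simp add: maxind_def phiC_def)

lemma outer_colours_antimono: "X \<subseteq> Y \<Longrightarrow> outer_colours G Y \<subseteq> outer_colours G X"
  unfolding outer_colours_def by blast

lemma monochromatic_insert:
  assumes "is_graph G" "monochromatic G c X" "\<And>x. x \<in> X \<Longrightarrow> adj G z x \<longleftrightarrow> c"
  shows "monochromatic G c (insert z X)"
  using assms is_graph_sym[OF assms(1)] unfolding monochromatic_def by blast

lemma ex_monochromatic_extension:
  assumes G: "is_graph G" and X: "X \<subseteq> verts G" "monochromatic G c X"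
  obtains Y where "X \<subseteq> Y" "Y \<subseteq> verts G" "monochromatic G c Y" "c \<notin> outer_colours G Y"
proof -
  have "finite {Y. Y \<subseteq> verts G \<and> monochromatic G c Y}" using is_graph_finite[OF G] by simp
  from finite_has_maximal2[OF this, of X] X
  obtain Y where Y: "X \<subseteq> Y" "Y \<subseteq> verts G" "monochromatic G c Y"
    and maximal: "\<And>Z. Z \<subseteq> verts G \<Longrightarrow> monochromatic G c Z \<Longrightarrow> Y \<subseteq> Z \<Longrightarrow> Y = Z" by auto
  have "c \<notin> outer_colours G Y"
  proof
    assume "c \<in> outer_colours G Y"
    then obtain z where z: "z \<in> verts G - Y" "\<forall>x\<in>Y. adj G z x \<longleftrightarrow> c"
      unfolding outer_colours_def by blast
    with monochromatic_insert[OF G Y(3)] have "monochromatic G c (insert z Y)" by blast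
    with maximal[of "insert z Y"] z Y(2) show False by blast
  qed
  with Y that show thesis by blast
qed

lemma bool_set_cases:
  fixes C :: "bool set"
  obtains "C = {}" | "C = {True}" | "C = {False}" | "C = UNIV"
  unfolding UNIV_bool by (metis (full_types) empty_iff insert_iff subsetI subset_antisym)

lemma empty_mem_mono_outer_colours_iff:
  assumes "is_graph G"
  shows "{} \<in> mono_outer_colours G c \<longleftrightarrow>
    (\<exists>X\<subseteq>verts G. monochromatic G c X \<and> (\<not> c) \<notin> outer_colours G X)"
proof
  assume "\<exists>X\<subseteq>verts G. monochromatic G c X \<and> (\<not> c) \<notin> outer_colours G X"
  then obtain X where X: "X \<subseteq> verts G" "monochromatic G c X" "(\<not> c) \<notin> outer_colours G X" by blast
  obtain Y where Y: "X \<subseteq> Y" "Y \<subseteq> verts G" "monochromatic G c Y" "c \<notin> outer_colours G Y"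
    using ex_monochromatic_extension[OF assms X(1,2)] .
  moreover have "(\<not> c) \<notin> outer_colours G Y" using outer_colours_antimono[OF Y(1)] X(3) by blast
  ultimately have "outer_colours G Y = {}" by (cases c; cases "outer_colours G Y" rule: bool_set_cases) auto
  with Y show "{} \<in> mono_outer_colours G c" unfolding mono_outer_colours_def by blast
qed (auto simp: mono_outer_colours_def)

lemma singleton_mem_mono_outer_colours_iff:
  "{d} \<in> mono_outer_colours G c \<longleftrightarrow>
    (\<exists>X\<subseteq>verts G. monochromatic G c X \<and> d \<in> outer_colours G X \<and> (\<not> d) \<notin> outer_colours G X)"
proof -
  have "outer_colours G X = {d} \<longleftrightarrow> d \<in> outer_colours G X \<and> (\<not> d) \<notin> outer_colours G X" for X
    by (cases d; cases "outer_colours G X" rule: bool_set_cases) auto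
  then show ?thesis unfolding mono_outer_colours_def image_iff by (metis (no_types, lifting) mem_Collect_eq)
qed

lemma phiC123_iff_mono_outer_colours:
  assumes "is_graph G"
  shows "phiC1 G \<longleftrightarrow> {} \<notin> mono_outer_colours G True"
    and "phiC2 G \<longleftrightarrow> {False} \<notin> mono_outer_colours G True"
    and "phiC3 G \<longleftrightarrow> {True} \<notin> mono_outer_colours G True"
  unfolding phiC1_def phiC2_def phiC3_def maxcl_iff_not_phiI cl_iff_monochromatic
    phiC_iff_outer_colours phiI_iff_outer_colours
    empty_mem_mono_outer_colours_iff[OF assms] singleton_mem_mono_outer_colours_iff by auto

lemma phiI123_iff_mono_outer_colours:
  assumes "is_graph G"
  shows "phiI1 G \<longleftrightarrow> {} \<notin> mono_outer_colours G False"
    and "phiI2 G \<longleftrightarrow> {True} \<notin> mono_outer_colours G False"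
    and "phiI3 G \<longleftrightarrow> {False} \<notin> mono_outer_colours G False"
  unfolding phiI1_def phiI2_def phiI3_def maxind_iff_not_phiC ind_iff_monochromatic[OF assms]
    phiC_iff_outer_colours phiI_iff_outer_colours
    empty_mem_mono_outer_colours_iff[OF assms] singleton_mem_mono_outer_colours_iff by auto

lemma UNIV_mem_mono_outer_colours:
  assumes "verts G \<noteq> {}"
  shows "UNIV \<in> mono_outer_colours G c"
proof -
  have "outer_colours G {} = UNIV" "monochromatic G c {}"
    using assms by (auto simp: outer_colours_def monochromatic_def)
  then show ?thesis unfolding mono_outer_colours_def by (metis (mono_tags) empty_subsetI image_eqI mem_Collect_eq)
qed

lemma mono_outer_colours_eqI:
  assumes G: "is_graph G" "verts G \<noteq> {}" and H: "is_graph H" "verts H \<noteq> {}"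
    and "phiC1 G \<longleftrightarrow> phiC1 H" "phiC2 G \<longleftrightarrow> phiC2 H" "phiC3 G \<longleftrightarrow> phiC3 H"
    and "phiI1 G \<longleftrightarrow> phiI1 H" "phiI2 G \<longleftrightarrow> phiI2 H" "phiI3 G \<longleftrightarrow> phiI3 H"
  shows "mono_outer_colours G = mono_outer_colours H"
proof (intro ext set_eqI)
  fix c C
  show "C \<in> mono_outer_colours G c \<longleftrightarrow> C \<in> mono_outer_colours H c"
    using assms(5-10) UNIV_mem_mono_outer_colours[OF G(2)] UNIV_mem_mono_outer_colours[OF H(2)]
    unfolding phiC123_iff_mono_outer_colours[OF G(1)] phiC123_iff_mono_outer_colours[OF H(1)]
      phiI123_iff_mono_outer_colours[OF G(1)] phiI123_iff_mono_outer_colours[OF H(1)]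
    by (cases c; cases C rule: bool_set_cases) auto
qed

section \<open>Vertex types under the extension property\<close>

definition one_sided :: "graph \<Rightarrow> nat set \<Rightarrow> bool" where
  "one_sided G X \<longleftrightarrow> (\<forall>v\<in>verts G. colours G (verts G - X) v = UNIV)"

definition mixed_sides :: "graph \<Rightarrow> nat set \<Rightarrow> bool set" where
  "mixed_sides G X = {b. \<exists>v\<in>verts G. (v \<in> X \<longleftrightarrow> b) \<and> colours G X v = UNIV}"

definition pure_sides :: "graph \<Rightarrow> nat set \<Rightarrow> (bool \<times> bool) set" where
  "pure_sides G X = {(b, c). \<exists>v\<in>verts G. (v \<in> X \<longleftrightarrow> b) \<and> colours G X v = {c}}"

definition one_sided_types :: "bool set \<Rightarrow> (bool \<times> bool) set \<Rightarrow> vertex_type set" where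
  "one_sided_types M D = (\<lambda>b. (b, UNIV, UNIV)) ` M \<union> (\<lambda>(b, c). (b, {c}, UNIV)) ` D"

definition singleton_types :: "vertex_type set" where
  "singleton_types = {(True, {}, UNIV), (False, {True}, UNIV), (False, {False}, UNIV)}"

definition star_types :: "bool \<Rightarrow> bool \<Rightarrow> vertex_type set" where
  "star_types b c = {(b, {c}, {\<not> c}), (True, UNIV, UNIV), (False, UNIV, UNIV)}"

inductive_set admissible_types ::
  "(bool \<Rightarrow> bool set set) \<Rightarrow> vertex_type set set" for K where
  empty: "{(False, {}, UNIV)} \<in> admissible_types K"
| singleton: "singleton_types \<in> admissible_types K"
| star: "star_types b c \<in> admissible_types K"
| generic: "\<not> {True} \<times> UNIV \<subseteq> D \<Longrightarrow> one_sided_types UNIV D \<in> admissible_types K"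
| monochromatic: "C \<in> K c \<Longrightarrow>
    one_sided_types {False} (insert (True, c) ({False} \<times> C)) \<in> admissible_types K"
| swap: "\<T> \<in> admissible_types K \<Longrightarrow> swap_sides ` \<T> \<in> admissible_types K"

lemma colours_eq_empty_iff: "colours G X v = {} \<longleftrightarrow> X \<subseteq> {v}"
  by (auto simp: colours_def)

lemma colours_Un: "colours G (A \<union> B) v = colours G A v \<union> colours G B v"
  by (auto simp: colours_def)

lemma vtypes_eq_one_sided_types:
  assumes "one_sided G X" "\<And>v. \<not> X \<subseteq> {v}"
  shows "vtypes G X = one_sided_types (mixed_sides G X) (pure_sides G X)"
proof (intro equalityI subsetI)
  fix \<tau> assume "\<tau> \<in> vtypes G X"
  then obtain v where v: "v \<in> verts G" "\<tau> = (v \<in> X, colours G X v, UNIV)"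
    using assms(1) by (auto simp: vtypes_def vtype_def one_sided_def)
  have "colours G X v \<noteq> {}" using assms(2) colours_eq_empty_iff by blast
  then consider "colours G X v = UNIV" | c where "colours G X v = {c}"
    by (cases "colours G X v" rule: bool_set_cases) auto
  then show "\<tau> \<in> one_sided_types (mixed_sides G X) (pure_sides G X)"
  proof cases
    case 1
    then have "(v \<in> X) \<in> mixed_sides G X" using v(1) unfolding mixed_sides_def by blast
    then show ?thesis using v(2) 1 unfolding one_sided_types_def by blast
  next
    case 2
    then have "(v \<in> X, c) \<in> pure_sides G X" using v(1) unfolding pure_sides_def by blast
    then show ?thesis using v(2) 2 unfolding one_sided_types_def by force
  qed
next
  fix \<tau> assume "\<tau> \<in> one_sided_types (mixed_sides G X) (pure_sides G X)"
  then obtain v where "v \<in> verts G" "\<tau> = (v \<in> X, colours G X v, UNIV)"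
    by (auto simp: one_sided_types_def mixed_sides_def pure_sides_def)
  then show "\<tau> \<in> vtypes G X" using assms(1) by (auto simp: vtypes_def vtype_def one_sided_def)
qed

lemma colours_monochromatic:
  assumes "monochromatic G c X" "v \<in> X" "\<not> X \<subseteq> {v}"
  shows "colours G X v = {c}"
proof -
  have "colours G X v \<subseteq> {c}" using assms(1,2) by (auto simp: monochromatic_def colours_def)
  moreover have "colours G X v \<noteq> {}" using assms(3) colours_eq_empty_iff by blast
  ultimately show ?thesis by blast
qed

lemma mem_outer_colours_iff:
  assumes "X \<noteq> {}"
  shows "c \<in> outer_colours G X \<longleftrightarrow> (\<exists>z\<in>verts G - X. colours G X z = {c})"
proof -
  have "(\<forall>x\<in>X. adj G z x \<longleftrightarrow> c) \<longleftrightarrow> colours G X z = {c}" if "z \<notin> X" for z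
    using assms that unfolding colours_def by auto
  then show ?thesis unfolding outer_colours_def by blast
qed

lemma pure_sides_monochromatic:
  assumes "X \<subseteq> verts G" "monochromatic G c X" "\<And>v. \<not> X \<subseteq> {v}"
  shows "pure_sides G X = insert (True, c) ({False} \<times> outer_colours G X)"
proof -
  obtain x where x: "x \<in> X" using assms(3) by blast
  have colours: "colours G X v = {c}" if "v \<in> X" for v
    using colours_monochromatic[OF assms(2) that assms(3)] .
  have inner: "(True, d) \<in> pure_sides G X \<longleftrightarrow> d = c" for d
  proof
    assume "(True, d) \<in> pure_sides G X"
    then obtain v where "v \<in> X" "colours G X v = {d}" by (auto simp: pure_sides_def)
    then show "d = c" using colours[of v] by simp
  next
    assume "d = c"
    moreover have "x \<in> verts G" using x assms(1) by blast
    ultimately show "(True, d) \<in> pure_sides G X"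
      using x colours[OF x] by (auto simp: pure_sides_def intro!: bexI[of _ x])
  qed
  have outer: "(False, d) \<in> pure_sides G X \<longleftrightarrow> d \<in> outer_colours G X" for d
  proof -
    have "X \<noteq> {}" using x by blast
    then show ?thesis unfolding pure_sides_def by (simp add: mem_outer_colours_iff) blast
  qed
  show ?thesis
  proof (rule set_eqI)
    fix p
    show "p \<in> pure_sides G X \<longleftrightarrow> p \<in> insert (True, c) ({False} \<times> outer_colours G X)"
      using inner outer by (cases p; cases "fst p") simp_all
  qed
qed

locale ext_graph =
  fixes G :: graph and s :: nat
  assumes graph: "is_graph G" and ext: "ext_prop s G"
begin

lemmas adj_sym = is_graph_sym[OF graph]
lemmas finite_verts = is_graph_finite[OF graph]

lemma mem_colours_iff_sym: "c \<in> colours G A v \<longleftrightarrow> (\<exists>u\<in>A. u \<noteq> v \<and> adj G u v = c)"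
  using adj_sym unfolding mem_colours_iff by metis

lemma ext_witness:
  assumes S: "S \<subseteq> verts G" "card S \<le> s"
  shows "\<exists>z\<in>verts G - S. \<forall>x\<in>S. adj G z x \<longleftrightarrow> \<pi> x"
proof -
  obtain S' where S': "S \<subseteq> S'" "S' \<subseteq> verts G" "card S' = s"
    using exists_subset_between[OF S(2) _ S(1) finite_verts] ext by (auto simp: ext_prop_def)
  define T where "T = {x\<in>S'. \<pi> x}"
  have "T \<subseteq> S'" by (auto simp: T_def)
  then obtain z where "z \<in> verts G" "z \<notin> S'" "\<forall>t\<in>T. adj G z t" "\<forall>u\<in>S' - T. \<not> adj G z u"
    using ext S'(2,3) unfolding ext_prop_def by blast
  with S'(1) show ?thesis by (intro bexI[of _ z]) (auto simp: T_def)
qed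

lemma verts_nonempty: "verts G \<noteq> {}"
  using ext_witness[of "{}"] by auto

lemma ext_witness1:
  assumes "1 \<le> s" "u \<in> verts G"
  obtains z where "z \<in> verts G" "z \<noteq> u" "adj G z u = a"
  using ext_witness[of "{u}" "\<lambda>_. a"] assms that by auto

lemma ext_witness2:
  assumes "2 \<le> s" "u \<in> verts G" "v \<in> verts G" "u \<noteq> v"
  obtains z where "z \<in> verts G" "z \<noteq> u" "z \<noteq> v" "adj G z u = a" "adj G z v = b"
  using ext_witness[of "{u, v}" "\<lambda>x. if x = u then a else b"] assms that by auto

lemma colours_verts:
  assumes "1 \<le> s" "v \<in> verts G"
  shows "colours G (verts G) v = UNIV"
proof (rule UNIV_eq_I[symmetric])
  fix c
  obtain z where "z \<in> verts G" "z \<noteq> v" "adj G z v = c" using ext_witness1[OF assms] .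
  then show "c \<in> colours G (verts G) v" by (auto simp: mem_colours_iff_sym)
qed

lemma colours_other_side:
  assumes "2 \<le> s" and u: "u \<in> verts G" "colours G X u \<noteq> UNIV" and v: "v \<in> verts G" "v \<noteq> u"
  shows "colours G (verts G - X) v = UNIV"
proof (rule UNIV_eq_I[symmetric])
  fix d
  obtain c where c: "c \<notin> colours G X u" using u(2) by blast
  obtain z where z: "z \<in> verts G" "z \<noteq> u" "z \<noteq> v" "adj G z u = c" "adj G z v = d"
    using ext_witness2[OF assms(1) u(1) v(1) v(2)[symmetric]] .
  then have "z \<notin> X" using c unfolding mem_colours_iff_sym by blast
  with z show "d \<in> colours G (verts G - X) v" by (auto simp: mem_colours_iff_sym)
qed

lemma one_sided_if_pure_vertex:
  assumes "2 \<le> s" "u \<in> verts G" "colours G X u \<noteq> UNIV" "colours G (verts G - X) u = UNIV"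
  shows "one_sided G X"
  unfolding one_sided_def
proof
  fix v assume "v \<in> verts G"
  then show "colours G (verts G - X) v = UNIV"
    using colours_other_side[OF assms(1-3)] assms(4) by (cases "v = u") blast+
qed

lemma vtypes_empty:
  assumes "1 \<le> s"
  shows "vtypes G {} = {(False, {}, UNIV)}"
proof -
  have "vtype G {} v = (False, {}, UNIV)" if "v \<in> verts G" for v
    using colours_verts[OF assms that] by (simp add: vtype_def colours_def)
  moreover obtain v where "v \<in> verts G" using verts_nonempty by blast
  ultimately show ?thesis unfolding vtypes_def by force
qed

lemma vtypes_singleton:
  assumes s: "2 \<le> s" and v: "v \<in> verts G"
  shows "vtypes G {v} = singleton_types"
proof -
  have "colours G (verts G) v = colours G (verts G - {v}) v" by (simp add: colours_def)
  then have "one_sided G {v}"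
    using one_sided_if_pure_vertex[OF s v, of "{v}"] colours_verts[OF _ v] s by (simp add: colours_def)
  then have type: "vtype G {v} u = (u = v, if u = v then {} else {adj G u v}, UNIV)" if "u \<in> verts G" for u
    using that by (auto simp: vtype_def one_sided_def colours_def)
  have "1 \<le> s" using s by simp
  obtain x where x: "x \<in> verts G" "x \<noteq> v" "adj G x v = True" by (rule ext_witness1[OF \<open>1 \<le> s\<close> v])
  obtain y where y: "y \<in> verts G" "y \<noteq> v" "adj G y v = False" by (rule ext_witness1[OF \<open>1 \<le> s\<close> v])
  have "{vtype G {v} v, vtype G {v} x, vtype G {v} y} \<subseteq> vtypes G {v}"
    using v x(1) y(1) by (simp add: vtypes_def)
  then have "singleton_types \<subseteq> vtypes G {v}"
    using type[OF v] type[OF x(1)] type[OF y(1)] x y by (simp add: singleton_types_def)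
  moreover have "vtypes G {v} \<subseteq> singleton_types"
    unfolding vtypes_def image_subset_iff by (auto simp: type singleton_types_def)
  ultimately show ?thesis by (rule subset_antisym[rotated])
qed

lemma vtypes_star:
  assumes s: "2 \<le> s" and u: "u \<in> verts G" "colours G X u = {c}" "colours G (verts G - X) u = {\<not> c}"
  shows "vtypes G X = star_types (u \<in> X) c"
proof -
  have "{c} \<noteq> UNIV" for c :: bool by auto
  then have pure: "colours G X u \<noteq> UNIV" "colours G (verts G - X) u \<noteq> UNIV" using u by metis+
  have "colours G X v = UNIV" "colours G (verts G - X) v = UNIV" if "v \<in> verts G" "v \<noteq> u" for v
  proof -
    show "colours G (verts G - X) v = UNIV" by (rule colours_other_side[OF s u(1) pure(1) that])
    have "colours G (verts G - (verts G - X)) v = UNIV" by (rule colours_other_side[OF s u(1) pure(2) that])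
    then show "colours G X v = UNIV" by (auto simp: colours_def)
  qed
  then have type: "vtype G X v = (if v = u then (u \<in> X, {c}, {\<not> c}) else (v \<in> X, UNIV, UNIV))"
    if "v \<in> verts G" for v
    using that u by (simp add: vtype_def)
  have "1 \<le> s" using s by simp
  obtain x where x: "x \<in> verts G" "x \<noteq> u" "adj G x u = c" by (rule ext_witness1[OF \<open>1 \<le> s\<close> u(1)])
  obtain y where y: "y \<in> verts G" "y \<noteq> u" "adj G y u = (\<not> c)" by (rule ext_witness1[OF \<open>1 \<le> s\<close> u(1)])
  have "x \<in> X" using x u(3) unfolding set_eq_iff mem_colours_iff_sym by blast
  moreover have "y \<notin> X" using y u(2) unfolding set_eq_iff mem_colours_iff_sym by blast
  ultimately have "vtype G X x = (True, UNIV, UNIV)" "vtype G X y = (False, UNIV, UNIV)"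
    using type[OF x(1)] type[OF y(1)] x(2) y(2) by simp_all
  moreover have "{vtype G X u, vtype G X x, vtype G X y} \<subseteq> vtypes G X"
    using u(1) x(1) y(1) by (simp add: vtypes_def)
  ultimately have "star_types (u \<in> X) c \<subseteq> vtypes G X"
    using type[OF u(1)] by (simp add: star_types_def)
  moreover have "vtypes G X \<subseteq> star_types (u \<in> X) c"
    using type unfolding vtypes_def star_types_def by auto
  ultimately show ?thesis by (rule subset_antisym[rotated])
qed

lemma star_types_mem_vtype_sets:
  assumes s: "2 \<le> s"
  shows "star_types b c \<in> vtype_sets G"
proof -
  obtain u where u: "u \<in> verts G" using verts_nonempty by blast
  define X where "X = {v \<in> verts G - {u}. adj G u v = c} \<union> (if b then {u} else {})"
  have X: "X \<subseteq> verts G" "u \<in> X \<longleftrightarrow> b" using u by (auto simp: X_def)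
  have "colours G X u \<subseteq> {c}" "colours G (verts G - X) u \<subseteq> {\<not> c}"
    by (auto simp: colours_def X_def)
  moreover have "colours G X u \<union> colours G (verts G - X) u = UNIV"
    using colours_verts[OF _ u] s X(1) unfolding colours_Un[symmetric] by (simp add: Un_absorb1)
  ultimately have "colours G X u = {c}" "colours G (verts G - X) u = {\<not> c}" by auto
  from vtypes_star[OF s u this] have "vtypes G X = star_types b c" unfolding X(2) .
  then show ?thesis using X(1) unfolding vtype_sets_def by blast
qed

lemma False_mem_mixed_sides:
  assumes s: "3 \<le> s" and X: "X \<subseteq> verts G" "\<And>v. \<not> X \<subseteq> {v}" and "one_sided G X"
  shows "False \<in> mixed_sides G X"
proof -
  obtain v where "v \<in> verts G" using verts_nonempty by blast
  then have "True \<in> colours G (verts G - X) v" using assms(4) unfolding one_sided_def by blast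
  then obtain y where y: "y \<in> verts G - X" unfolding mem_colours_iff by blast
  show ?thesis
  proof (cases "colours G X y = UNIV")
    case True
    then show ?thesis using y by (auto simp: mixed_sides_def)
  next
    case False
    then obtain c where c: "c \<notin> colours G X y" by blast
    obtain x where x: "x \<in> X" using X(2) by blast
    then obtain x' where x': "x' \<in> X" "x' \<noteq> x" using X(2)[of x] by blast
    have "{x, x', y} \<subseteq> verts G" "card {x, x', y} \<le> s"
      using X(1) x x' y card_length[of "[x, x', y]"] s by auto
    from ext_witness[OF this, of "\<lambda>v. if v = y then c else v = x"] obtain z where z: "z \<in> verts G - {x, x', y}"
      and adj_z: "\<forall>v\<in>{x, x', y}. adj G z v \<longleftrightarrow> (if v = y then c else v = x)" by blast
    have "adj G z y = c" "adj G z x" "\<not> adj G z x'" using adj_z x x' y by auto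
    then have "z \<notin> X" using c z unfolding mem_colours_iff_sym by blast
    have "True \<in> colours G X z" "False \<in> colours G X z"
      using z x x'(1) \<open>adj G z x\<close> \<open>\<not> adj G z x'\<close> by (auto simp: mem_colours_iff)
    then have "colours G X z = UNIV" by (cases "colours G X z" rule: bool_set_cases) auto
    then show ?thesis using z \<open>z \<notin> X\<close> by (auto simp: mixed_sides_def)
  qed
qed

lemma one_sided_monochromatic:
  assumes s: "2 \<le> s" and X: "X \<subseteq> verts G" "monochromatic G c X" "\<And>v. \<not> X \<subseteq> {v}"
  shows "one_sided G X"
  unfolding one_sided_def
proof (intro ballI UNIV_eq_I[symmetric])
  fix v d assume v: "v \<in> verts G"
  obtain x where x: "x \<in> X" "x \<noteq> v" using X(3)[of v] by blast
  then have "x \<in> verts G" using X(1) by blast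
  from ext_witness2[OF s this v x(2)]
  obtain z where z: "z \<in> verts G" "z \<noteq> x" "z \<noteq> v" "adj G z x = (\<not> c)" "adj G z v = d" .
  then have "z \<notin> X" using X(2) x(1) unfolding monochromatic_def by blast
  with z show "d \<in> colours G (verts G - X) v" by (auto simp: mem_colours_iff_sym)
qed

lemma mixed_sides_monochromatic:
  assumes s: "3 \<le> s" and X: "X \<subseteq> verts G" "monochromatic G c X" "\<And>v. \<not> X \<subseteq> {v}"
  shows "mixed_sides G X = {False}"
proof -
  have "colours G X v \<noteq> UNIV" if "v \<in> X" for v
    unfolding colours_monochromatic[OF X(2) that X(3)] by (cases c) auto
  then have "True \<notin> mixed_sides G X" by (auto simp: mixed_sides_def)
  moreover have "False \<in> mixed_sides G X"
    using False_mem_mixed_sides[OF s X(1,3) one_sided_monochromatic[OF _ X]] s by simp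
  ultimately show ?thesis by (cases "mixed_sides G X" rule: bool_set_cases) simp_all
qed

lemma vtypes_monochromatic:
  assumes s: "3 \<le> s" and X: "X \<subseteq> verts G" "monochromatic G c X" "\<And>v. \<not> X \<subseteq> {v}"
  shows "vtypes G X = one_sided_types {False} (insert (True, c) ({False} \<times> outer_colours G X))"
  using vtypes_eq_one_sided_types[OF one_sided_monochromatic[OF _ X] X(3)] s
    mixed_sides_monochromatic[OF assms] pure_sides_monochromatic[OF X] by simp

lemma outer_colours_subset_singleton:
  assumes "1 \<le> s" "v \<in> verts G" "X \<subseteq> {v}"
  shows "outer_colours G X = UNIV"
proof (rule UNIV_eq_I[symmetric])
  fix c
  obtain z where "z \<in> verts G" "z \<noteq> v" "adj G z v = c" using ext_witness1[OF assms(1,2)] .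
  with assms(3) show "c \<in> outer_colours G X" unfolding outer_colours_def by blast
qed

lemma ex_monochromatic_pair:
  assumes "2 \<le> s"
  obtains u v where "u \<noteq> v" "{u, v} \<subseteq> verts G" "monochromatic G c {u, v}" "outer_colours G {u, v} = UNIV"
proof -
  obtain u where u: "u \<in> verts G" using verts_nonempty by blast
  have "1 \<le> s" using assms by simp
  obtain v where v: "v \<in> verts G" "v \<noteq> u" "adj G v u = c" by (rule ext_witness1[OF \<open>1 \<le> s\<close> u])
  have "d \<in> outer_colours G {u, v}" for d
  proof -
    obtain z where "z \<in> verts G" "z \<noteq> u" "z \<noteq> v" "adj G z u = d" "adj G z v = d"
      by (rule ext_witness2[OF assms u v(1) v(2)[symmetric]])
    then show ?thesis by (auto simp: outer_colours_def)
  qed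
  moreover have "monochromatic G c {u, v}" using v adj_sym[of u v] by (auto simp: monochromatic_def)
  ultimately show thesis using that[of u v] u v(1,2) by blast
qed

lemma monochromatic_types_mem_vtype_sets:
  assumes s: "3 \<le> s" and "C \<in> mono_outer_colours G c"
  shows "one_sided_types {False} (insert (True, c) ({False} \<times> C)) \<in> vtype_sets G"
proof -
  obtain X where X: "X \<subseteq> verts G" "monochromatic G c X" "C = outer_colours G X"
    using assms(2) by (auto simp: mono_outer_colours_def)
  show ?thesis
  proof (cases "\<exists>v\<in>verts G. X \<subseteq> {v}")
    case True
    then have "C = UNIV" using outer_colours_subset_singleton s X(3) by fastforce
    have "2 \<le> s" using s by simp
    then obtain u v where uv: "u \<noteq> v" "{u, v} \<subseteq> verts G" "monochromatic G c {u, v}"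
      and outer: "outer_colours G {u, v} = UNIV" by (rule ex_monochromatic_pair)
    have "\<not> {u, v} \<subseteq> {w}" for w using uv(1) by blast
    from vtypes_monochromatic[OF s uv(2,3) this] show ?thesis
      using uv(2) unfolding vtype_sets_def outer \<open>C = UNIV\<close> by blast
  next
    case False
    then have "\<not> X \<subseteq> {v}" for v using X(1) verts_nonempty by (cases "v \<in> verts G") auto
    from vtypes_monochromatic[OF s X(1,2) this] show ?thesis
      using X(1,3) unfolding vtype_sets_def by blast
  qed
qed

lemma ext_witness_balanced:
  assumes s: "card P + 3 \<le> s" and P: "P \<subseteq> verts G" and a: "a \<in> verts G - P"
    and a': "a' \<in> verts G - insert a P" and v: "v \<in> verts G"
  obtains x where "x \<in> verts G - insert v (insert a (insert a' P))" "adj G x v \<longleftrightarrow> d"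
    "(adj G x a \<longleftrightarrow> adj G x a') \<longleftrightarrow> e" "\<forall>p\<in>P - {v}. adj G x p \<longleftrightarrow> \<kappa> p"
proof -
  let ?S = "insert v (insert a (insert a' P))"
  have "finite P" using P finite_verts finite_subset by blast
  then have "card ?S \<le> s" using s by (simp add: card_insert_if)
  moreover have "?S \<subseteq> verts G" using v a a' P by auto
  ultimately have "\<exists>x\<in>verts G - ?S. \<forall>y\<in>?S. adj G x y \<longleftrightarrow> (if y = v then d else
      if y = a then e = (v = a' \<longrightarrow> d) else if y = a' then v = a \<longrightarrow> d = e else \<kappa> y)"
    by (intro ext_witness)
  then obtain x where x: "x \<in> verts G - ?S" and adj_x: "\<And>y. y \<in> ?S \<Longrightarrow> adj G x y \<longleftrightarrow> (if y = v then d else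
      if y = a then e = (v = a' \<longrightarrow> d) else if y = a' then v = a \<longrightarrow> d = e else \<kappa> y)" by blast
  show thesis
  proof (rule that[OF x])
    show "adj G x v \<longleftrightarrow> d" using adj_x[of v] by simp
    show "(adj G x a \<longleftrightarrow> adj G x a') \<longleftrightarrow> e"
      using adj_x[of a] adj_x[of a'] a' by (cases "v = a"; cases "v = a'") auto
    show "\<forall>p\<in>P - {v}. adj G x p \<longleftrightarrow> \<kappa> p" using adj_x a a' by auto
  qed
qed

text \<open>Splitting the vertices by whether they agree on \<open>a\<close> and \<open>a'\<close> keeps the complement generic.\<close>

definition prescribed_set :: "nat \<Rightarrow> nat \<Rightarrow> (nat \<Rightarrow> bool) \<Rightarrow> nat set \<Rightarrow> nat set \<Rightarrow> nat set" where
  "prescribed_set a a' \<kappa> P Q = Q \<union> {x \<in> verts G - insert a (insert a' P).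
     (adj G x a \<longleftrightarrow> adj G x a') \<and> (\<forall>p\<in>P. adj G x p \<longleftrightarrow> \<kappa> p)}"

lemma one_sided_prescribed_set:
  assumes "card P + 3 \<le> s" "P \<subseteq> verts G" "a \<in> verts G - P" "a' \<in> verts G - insert a P" and Q: "Q \<subseteq> P"
  shows "one_sided G (prescribed_set a a' \<kappa> P Q)"
  unfolding one_sided_def
proof (intro ballI UNIV_eq_I[symmetric])
  fix v d assume v: "v \<in> verts G"
  obtain x where "x \<in> verts G - insert v (insert a (insert a' P))" "adj G x v \<longleftrightarrow> d"
    "(adj G x a \<longleftrightarrow> adj G x a') \<longleftrightarrow> False"
    by (rule ext_witness_balanced[OF assms(1-4) v])
  then show "d \<in> colours G (verts G - prescribed_set a a' \<kappa> P Q) v"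
    using Q by (auto simp: mem_colours_iff_sym prescribed_set_def)
qed

lemma mem_colours_prescribed_set:
  assumes "card P + 3 \<le> s" "P \<subseteq> verts G" "a \<in> verts G - P" "a' \<in> verts G - insert a P"
    and v: "v \<in> verts G" "v \<in> P \<Longrightarrow> d = \<kappa> v"
  shows "d \<in> colours G (prescribed_set a a' \<kappa> P Q - P) v"
proof -
  obtain x where x: "x \<in> verts G - insert v (insert a (insert a' P))" "adj G x v \<longleftrightarrow> d"
    "(adj G x a \<longleftrightarrow> adj G x a') \<longleftrightarrow> True" "\<forall>p\<in>P - {v}. adj G x p \<longleftrightarrow> \<kappa> p"
    by (rule ext_witness_balanced[OF assms(1-4) v(1), where d = d and e = True and \<kappa> = \<kappa>])
  moreover have "adj G x p \<longleftrightarrow> \<kappa> p" if "p \<in> P" for p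
    using x(2,4) that v(2) by (cases "p = v") auto
  ultimately have "x \<in> prescribed_set a a' \<kappa> P Q - P" by (auto simp: prescribed_set_def)
  with x(1,2) show ?thesis by (auto simp: mem_colours_iff_sym)
qed

lemma colours_prescribed_set:
  assumes s: "card P + 3 \<le> s" and P: "P \<subseteq> verts G" and a: "a \<in> verts G - P"
    and a': "a' \<in> verts G - insert a P"
    and compatible: "\<And>p q. p \<in> P \<Longrightarrow> q \<in> Q \<Longrightarrow> q \<noteq> p \<Longrightarrow> adj G q p \<longleftrightarrow> \<kappa> p"
  shows "p \<in> P \<Longrightarrow> colours G (prescribed_set a a' \<kappa> P Q) p = {\<kappa> p}"
    and "v \<in> verts G - P \<Longrightarrow> colours G (prescribed_set a a' \<kappa> P Q) v = UNIV"
proof -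
  have mem: "d \<in> colours G (prescribed_set a a' \<kappa> P Q) v" if "v \<in> verts G" "v \<in> P \<longrightarrow> d = \<kappa> v" for v d
  proof -
    have "d \<in> colours G (prescribed_set a a' \<kappa> P Q - P) v"
      using that by (intro mem_colours_prescribed_set[OF s P a a']) auto
    then show ?thesis unfolding mem_colours_iff by blast
  qed
  show "colours G (prescribed_set a a' \<kappa> P Q) p = {\<kappa> p}" if p: "p \<in> P"
  proof
    show "{\<kappa> p} \<subseteq> colours G (prescribed_set a a' \<kappa> P Q) p" using mem[of p "\<kappa> p"] p P by auto
    show "colours G (prescribed_set a a' \<kappa> P Q) p \<subseteq> {\<kappa> p}"
      using compatible[OF p] p by (auto simp: mem_colours_iff_sym prescribed_set_def)
  qed
  show "colours G (prescribed_set a a' \<kappa> P Q) v = UNIV" if "v \<in> verts G - P"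
    using mem[of v] that by (intro UNIV_eq_I[symmetric]) auto
qed

lemma pure_sides_eq_image:
  assumes "P \<subseteq> verts G" "\<And>p. p \<in> P \<Longrightarrow> colours G X p = {\<kappa> p}"
    and "\<And>v. v \<in> verts G - P \<Longrightarrow> colours G X v = UNIV"
  shows "pure_sides G X = (\<lambda>p. (p \<in> X, \<kappa> p)) ` P"
proof -
  have "colours G X v = {c} \<longleftrightarrow> v \<in> P \<and> \<kappa> v = c" if "v \<in> verts G" for v c
  proof (cases "v \<in> P")
    case False
    moreover have "{c} \<noteq> UNIV" by (cases c) auto
    ultimately show ?thesis using assms(3)[of v] that by auto
  qed (simp add: assms(2))
  then have "pure_sides G X = {(b, c). \<exists>v\<in>verts G. (v \<in> X \<longleftrightarrow> b) \<and> v \<in> P \<and> \<kappa> v = c}"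
    by (simp add: pure_sides_def)
  then show ?thesis using assms(1) by auto
qed

lemma prescribed_types_mem_vtype_sets:
  assumes s: "card P + 3 \<le> s" and P: "P \<subseteq> verts G" "Q \<subseteq> P"
    and compatible: "\<And>p q. p \<in> P \<Longrightarrow> q \<in> Q \<Longrightarrow> q \<noteq> p \<Longrightarrow> adj G q p \<longleftrightarrow> \<kappa> p"
  shows "one_sided_types UNIV ((\<lambda>p. (p \<in> Q, \<kappa> p)) ` P) \<in> vtype_sets G"
proof -
  have "finite P" using P(1) finite_verts finite_subset by blast
  obtain a where a: "a \<in> verts G - P" using ext_witness[OF P(1)] s by auto
  have "insert a P \<subseteq> verts G" "card (insert a P) \<le> s"
    using a P(1) s \<open>finite P\<close> by (auto simp: card_insert_if)
  then obtain a' where a': "a' \<in> verts G - insert a P" using ext_witness by blast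
  define X where "X = prescribed_set a a' \<kappa> P Q"
  have X: "X \<subseteq> verts G" "X \<inter> P = Q" "a \<notin> X"
    using P a by (auto simp: X_def prescribed_set_def)
  have pure: "colours G X p = {\<kappa> p}" if "p \<in> P" for p
    unfolding X_def by (rule colours_prescribed_set(1)[OF s P(1) a a' compatible that])
  have mixed: "colours G X v = UNIV" if "v \<in> verts G - P" for v
    unfolding X_def by (rule colours_prescribed_set(2)[OF s P(1) a a' compatible that])
  have "True \<in> colours G (X - P) a"
    unfolding X_def by (rule mem_colours_prescribed_set[OF s P(1) a a']) (use a in auto)
  then obtain x where x: "x \<in> X - P" by (auto simp: colours_def)
  then have "colours G X x = UNIV" "colours G X a = UNIV" using mixed a X(1) by auto
  then have "True \<in> mixed_sides G X" "False \<in> mixed_sides G X"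
    using x X(1,3) a by (auto simp: mixed_sides_def)
  then have mixed_sides: "mixed_sides G X = UNIV" by (cases "mixed_sides G X" rule: bool_set_cases) auto
  have "(\<lambda>p. (p \<in> X, \<kappa> p)) ` P = (\<lambda>p. (p \<in> Q, \<kappa> p)) ` P" using X(2) by (intro image_cong) auto
  then have pure_sides: "pure_sides G X = (\<lambda>p. (p \<in> Q, \<kappa> p)) ` P"
    using pure_sides_eq_image[OF P(1) pure mixed] by simp
  have "\<not> X \<subseteq> {v}" for v using \<open>colours G X x = UNIV\<close> x by (auto simp: colours_def)
  moreover have "one_sided G X" unfolding X_def by (rule one_sided_prescribed_set[OF s P(1) a a' P(2)])
  ultimately have "vtypes G X = one_sided_types UNIV ((\<lambda>p. (p \<in> Q, \<kappa> p)) ` P)"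
    using vtypes_eq_one_sided_types mixed_sides pure_sides by simp
  then show ?thesis using X(1) by (auto simp: vtype_sets_def)
qed

lemma generic_types_mem_vtype_sets:
  assumes s: "6 \<le> s" and D: "\<not> {True} \<times> UNIV \<subseteq> D"
  shows "one_sided_types UNIV D \<in> vtype_sets G"
proof -
  obtain c\<^sub>0 where c\<^sub>0: "(True, \<not> c\<^sub>0) \<notin> D"
  proof -
    from D obtain c where "(True, c) \<notin> D" by auto
    then show thesis using that[of "\<not> c"] by simp
  qed
  have "1 \<le> s" using s by simp
  obtain u where u: "u \<in> verts G" using verts_nonempty by blast
  obtain w where w: "w \<in> verts G" "w \<noteq> u" "adj G w u = True" by (rule ext_witness1[OF \<open>1 \<le> s\<close> u])
  obtain w' where w': "w' \<in> verts G" "w' \<noteq> u" "adj G w' u = False" by (rule ext_witness1[OF \<open>1 \<le> s\<close> u])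
  have "w \<noteq> w'" using w(3) w'(3) by auto
  define h where "h = (\<lambda>(b, c). if b then u else if c then w else w')"
  define \<kappa> where "\<kappa> x \<longleftrightarrow> x = w \<or> x = u \<and> c\<^sub>0" for x
  have h_range: "h ` D \<subseteq> {u, w, w'}" by (auto simp: h_def)
  have "(h (b, c) \<in> {u} \<inter> h ` D, \<kappa> (h (b, c))) = (b, c)" if "(b, c) \<in> D" for b c
  proof -
    have "b \<longrightarrow> c = c\<^sub>0" using that c\<^sub>0 by (cases "c = c\<^sub>0") auto
    moreover have "h (b, c) \<in> h ` D" using that by (rule imageI)
    ultimately show ?thesis using w(2) w'(2) \<open>w \<noteq> w'\<close> by (simp add: h_def \<kappa>_def)
  qed
  then have "(\<lambda>p. (p \<in> {u} \<inter> h ` D, \<kappa> p)) ` h ` D = (\<lambda>x. x) ` D"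
    unfolding image_image by (intro image_cong) auto
  moreover have "one_sided_types UNIV ((\<lambda>p. (p \<in> {u} \<inter> h ` D, \<kappa> p)) ` h ` D) \<in> vtype_sets G"
  proof (rule prescribed_types_mem_vtype_sets)
    have "card (h ` D) \<le> card {u, w, w'}" by (rule card_mono[OF _ h_range]) simp
    then show "card (h ` D) + 3 \<le> s" using s card_length[of "[u, w, w']"] by simp
    show "h ` D \<subseteq> verts G" using h_range u w(1) w'(1) by blast
    fix p q assume "p \<in> h ` D" "q \<in> {u} \<inter> h ` D" "q \<noteq> p"
    then have "q = u" "p = w \<or> p = w'" using h_range by auto
    then show "adj G q p \<longleftrightarrow> \<kappa> p"
      using w w' \<open>w \<noteq> w'\<close> adj_sym[of u w] adj_sym[of u w'] by (auto simp: \<kappa>_def)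
  qed simp
  ultimately show ?thesis by simp
qed

lemma admissible_types_subset_vtype_sets:
  assumes s: "6 \<le> s"
  shows "admissible_types (mono_outer_colours G) \<subseteq> vtype_sets G"
proof
  fix \<T> assume "\<T> \<in> admissible_types (mono_outer_colours G)"
  then show "\<T> \<in> vtype_sets G"
  proof induction
    case empty
    have "vtypes G {} \<in> vtype_sets G" by (simp add: vtype_sets_def)
    then show ?case using vtypes_empty s by simp
  next
    case singleton
    obtain v where "v \<in> verts G" using verts_nonempty by blast
    then have "vtypes G {v} \<in> vtype_sets G" by (simp add: vtype_sets_def)
    then show ?case using vtypes_singleton[of v] s \<open>v \<in> verts G\<close> by simp
  next
    case star
    then show ?case using star_types_mem_vtype_sets s by simp
  next
    case generic
    then show ?case using generic_types_mem_vtype_sets[OF s] by simp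
  next
    case monochromatic
    then show ?case using monochromatic_types_mem_vtype_sets s by simp
  next
    case (swap \<T>)
    then obtain X where X: "X \<subseteq> verts G" "\<T> = vtypes G X" by (auto simp: vtype_sets_def)
    have "vtypes G (verts G - X) \<in> vtype_sets G" by (simp add: vtype_sets_def)
    then show ?case unfolding vtypes_Diff[OF X(1)] X(2) .
  qed
qed

lemma pure_colour_inside_unique:
  assumes "(True, c) \<in> pure_sides G X" "(True, d) \<in> pure_sides G X"
  shows "c = d"
proof -
  obtain u v where u: "u \<in> X" "colours G X u = {c}" and v: "v \<in> X" "colours G X v = {d}"
    using assms by (auto simp: pure_sides_def)
  show ?thesis
  proof (cases "u = v")
    case True
    then show ?thesis using u v by simp
  next
    case False
    then have "adj G u v \<in> colours G X u" using v(1) by (auto simp: mem_colours_iff)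
    moreover have "adj G u v \<in> colours G X v" using u(1) False by (auto simp: mem_colours_iff_sym)
    ultimately show ?thesis using u(2) v(2) by simp
  qed
qed

lemma monochromatic_if_no_mixed:
  assumes X: "X \<subseteq> verts G" "\<And>v. \<not> X \<subseteq> {v}" and "True \<notin> mixed_sides G X"
  obtains c where "monochromatic G c X"
proof -
  have pure: "\<exists>c. colours G X v = {c}" if "v \<in> X" for v
  proof -
    have "v \<in> verts G" using that X(1) by blast
    then have "colours G X v \<noteq> UNIV" using that assms(3) by (auto simp: mixed_sides_def)
    moreover have "colours G X v \<noteq> {}" using X(2) colours_eq_empty_iff by blast
    ultimately show ?thesis by (cases "colours G X v" rule: bool_set_cases) auto
  qed
  obtain x where x: "x \<in> X" using X(2) by blast
  then obtain c where c: "colours G X x = {c}" using pure by blast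
  have "(True, d) \<in> pure_sides G X" if "v \<in> X" "colours G X v = {d}" for v d
    using that X(1) by (auto simp: pure_sides_def)
  then have "colours G X v = {c}" if "v \<in> X" for v
    using pure_colour_inside_unique x c pure[OF that] that by metis
  then have "monochromatic G c X" unfolding monochromatic_def colours_def by blast
  then show thesis by (rule that)
qed

lemma one_sided_vtypes_admissible:
  assumes s: "3 \<le> s" and X: "X \<subseteq> verts G" and one_sided: "one_sided G X"
  shows "vtypes G X \<in> admissible_types (mono_outer_colours G)"
proof -
  consider "X = {}" | v where "X = {v}" | "\<And>v. \<not> X \<subseteq> {v}" by blast
  then show ?thesis
  proof cases
    case 1
    then show ?thesis using vtypes_empty s admissible_types.empty by simp
  next
    case 2
    then show ?thesis using vtypes_singleton[of v] s X admissible_types.singleton by simp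
  next
    case 3
    note types = vtypes_eq_one_sided_types[OF one_sided 3]
    have False_mixed: "False \<in> mixed_sides G X" by (rule False_mem_mixed_sides[OF s X 3 one_sided])
    show ?thesis
    proof (cases "True \<in> mixed_sides G X")
      case True
      then have "mixed_sides G X = UNIV" using False_mixed by (cases "mixed_sides G X" rule: bool_set_cases) auto
      moreover have "\<not> {True} \<times> UNIV \<subseteq> pure_sides G X"
        using pure_colour_inside_unique[of True X False] by auto
      ultimately show ?thesis unfolding types by (simp add: admissible_types.generic)
    next
      case False
      obtain c where "monochromatic G c X" using monochromatic_if_no_mixed[OF X 3 False] .
      from vtypes_monochromatic[OF s X this 3] this X
      show ?thesis by (auto simp: mono_outer_colours_def intro!: admissible_types.monochromatic)
    qed
  qed
qed

lemma vtypes_admissible: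
  assumes s: "3 \<le> s" and X: "X \<subseteq> verts G"
  shows "vtypes G X \<in> admissible_types (mono_outer_colours G)"
proof -
  have X_eq: "verts G - (verts G - X) = X" using X by blast
  consider "one_sided G X" | "one_sided G (verts G - X)"
    | u u' where "u \<in> verts G" "colours G (verts G - X) u \<noteq> UNIV" "u' \<in> verts G" "colours G X u' \<noteq> UNIV"
    unfolding one_sided_def X_eq by blast
  then show ?thesis
  proof cases
    case 1
    then show ?thesis by (rule one_sided_vtypes_admissible[OF s X])
  next
    case 2
    have "swap_sides ` vtypes G (verts G - X) \<in> admissible_types (mono_outer_colours G)"
      by (intro admissible_types.swap one_sided_vtypes_admissible[OF s _ 2]) simp
    then show ?thesis using vtypes_Diff[of "verts G - X" G] by (simp add: X_eq)
  next
    case 3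
    have s2: "2 \<le> s" using s by simp
    have "u' = u" using colours_other_side[OF s2 3(3,4) 3(1)] 3(2) by blast
    have "colours G X u \<union> colours G (verts G - X) u = UNIV"
      using colours_verts[OF _ 3(1)] s X unfolding colours_Un[symmetric] by (simp add: Un_absorb1)
    then obtain c where "colours G X u = {c}" "colours G (verts G - X) u = {\<not> c}"
      using 3(2,4) \<open>u' = u\<close>
      by (cases "colours G X u" rule: bool_set_cases; cases "colours G (verts G - X) u" rule: bool_set_cases) auto
    from vtypes_star[OF s2 3(1) this] show ?thesis by (simp add: admissible_types.star)
  qed
qed

theorem vtype_sets_eq_admissible_types:
  assumes "6 \<le> s"
  shows "vtype_sets G = admissible_types (mono_outer_colours G)"
proof
  show "vtype_sets G \<subseteq> admissible_types (mono_outer_colours G)"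
    using vtypes_admissible assms by (auto simp: vtype_sets_def)
qed (rule admissible_types_subset_vtype_sets[OF assms])

end

lemma holds_E12_cong_if_same_sentences:
  assumes G: "ext_graph G s" and H: "ext_graph H s" and s: "6 \<le> s" and \<phi>: "E12 \<phi>"
    and "phiC1 G \<longleftrightarrow> phiC1 H" "phiC2 G \<longleftrightarrow> phiC2 H" "phiC3 G \<longleftrightarrow> phiC3 H"
    and "phiI1 G \<longleftrightarrow> phiI1 H" "phiI2 G \<longleftrightarrow> phiI2 H" "phiI3 G \<longleftrightarrow> phiI3 H"
  shows "holds_E12 G \<phi> \<longleftrightarrow> holds_E12 H \<phi>"
proof (rule holds_E12_cong_vtype_sets[OF _ _ \<phi>])
  show GH: "is_graph G" "is_graph H" using G H by (simp_all add: ext_graph.graph)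
  have "mono_outer_colours G = mono_outer_colours H"
    using assms(5-10) GH ext_graph.verts_nonempty[OF G] ext_graph.verts_nonempty[OF H]
    by (intro mono_outer_colours_eqI)
  then show "vtype_sets G = vtype_sets H"
    by (simp add: ext_graph.vtype_sets_eq_admissible_types[OF G s] ext_graph.vtype_sets_eq_admissible_types[OF H s])
qed

section \<open>Graphs with the extension property exist\<close>

lemma inj_parts: "inj (\<lambda>X. (X - (\<Union>v\<in>A. B v), \<lambda>v\<in>A. X \<inter> B v))"
proof (rule injI)
  fix X Y assume eq: "(X - (\<Union>v\<in>A. B v), \<lambda>v\<in>A. X \<inter> B v) = (Y - (\<Union>v\<in>A. B v), \<lambda>v\<in>A. Y \<inter> B v)"
  then have "(\<lambda>v\<in>A. X \<inter> B v) = (\<lambda>v\<in>A. Y \<inter> B v)" by simp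
  from fun_cong[OF this] have "X \<inter> B v = Y \<inter> B v" if "v \<in> A" for v using that by (metis restrict_apply')
  then have "X \<inter> (\<Union>v\<in>A. B v) = Y \<inter> (\<Union>v\<in>A. B v)" unfolding Int_UN_distrib by (intro SUP_cong refl)
  moreover have "X - (\<Union>v\<in>A. B v) = Y - (\<Union>v\<in>A. B v)" using eq by simp
  ultimately show "X = Y" by blast
qed

lemma card_avoid_patterns_le:
  fixes B P :: "'b \<Rightarrow> 'a set"
  assumes "finite A" "finite E" "disjoint_family_on B A"
    and B: "\<And>v. v \<in> A \<Longrightarrow> B v \<subseteq> E \<and> card (B v) = q \<and> P v \<subseteq> B v"
  shows "card {X. X \<subseteq> E \<and> (\<forall>v\<in>A. X \<inter> B v \<noteq> P v)} * 2 ^ (q * card A) \<le> 2 ^ card E * (2 ^ q - 1) ^ card A"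
proof -
  define E\<^sub>0 where "E\<^sub>0 = E - (\<Union>v\<in>A. B v)"
  let ?parts = "\<lambda>X. (X - (\<Union>v\<in>A. B v), \<lambda>v\<in>A. X \<inter> B v)"
  let ?codes = "Pow E\<^sub>0 \<times> (\<Pi>\<^sub>E v\<in>A. Pow (B v) - {P v})"
  have finB: "finite (B v)" if "v \<in> A" for v using B[OF that] \<open>finite E\<close> finite_subset by blast
  have "finite E\<^sub>0" using \<open>finite E\<close> by (simp add: E\<^sub>0_def)
  have UN: "(\<Union>v\<in>A. B v) \<subseteq> E" using B by blast
  have "card (\<Union>v\<in>A. B v) = q * card A"
    using card_UN_disjoint'[OF \<open>disjoint_family_on B A\<close> finB \<open>finite A\<close>] B by simp
  moreover have "card E\<^sub>0 = card E - card (\<Union>v\<in>A. B v)"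
    unfolding E\<^sub>0_def by (rule card_Diff_subset[OF finite_subset[OF UN \<open>finite E\<close>] UN])
  ultimately have card_E: "card E = card E\<^sub>0 + q * card A"
    using card_mono[OF \<open>finite E\<close> UN] by simp
  have "card (Pow (B v) - {P v}) = 2 ^ q - 1" if "v \<in> A" for v
    using B[OF that] finB[OF that] by (simp add: card_Diff_singleton card_Pow)
  then have card_codes: "card ?codes = 2 ^ card E\<^sub>0 * (2 ^ q - 1) ^ card A"
    using \<open>finite A\<close> \<open>finite E\<^sub>0\<close> by (simp add: card_cartesian_product card_PiE card_Pow)
  have "card {X. X \<subseteq> E \<and> (\<forall>v\<in>A. X \<inter> B v \<noteq> P v)} \<le> card ?codes"
  proof (rule card_inj_on_le[OF inj_on_subset[OF inj_parts subset_UNIV]])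
    show "?parts ` {X. X \<subseteq> E \<and> (\<forall>v\<in>A. X \<inter> B v \<noteq> P v)} \<subseteq> ?codes"
      by (auto simp: E\<^sub>0_def)
    show "finite ?codes"
      using finB \<open>finite A\<close> \<open>finite E\<^sub>0\<close> by (intro finite_cartesian_product finite_PiE) auto
  qed
  then show ?thesis unfolding card_codes card_E by (simp add: power_add)
qed

definition edge_set_graph :: "nat set \<Rightarrow> nat set set \<Rightarrow> graph" where
  "edge_set_graph U X = \<lparr>verts = U, adj = \<lambda>u v. u \<in> U \<and> v \<in> U \<and> u \<noteq> v \<and> {u, v} \<in> X\<rparr>"

lemma is_graph_edge_set_graph: "finite U \<Longrightarrow> is_graph (edge_set_graph U X)"
  unfolding is_graph_def edge_set_graph_def by (simp add: doubleton_eq_iff) (metis insert_commute)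

definition star_edges :: "nat \<Rightarrow> nat set \<Rightarrow> nat set set" where
  "star_edges v S = (\<lambda>u. {v, u}) ` S"

lemma card_star_edges: "card (star_edges v S) = card S"
  unfolding star_edges_def by (rule card_image) (auto simp: inj_on_def doubleton_eq_iff)

lemma ext_prop_edge_set_graph:
  assumes "s \<le> card U"
    and star: "\<And>S T. S \<subseteq> U \<Longrightarrow> card S = s \<Longrightarrow> T \<subseteq> S \<Longrightarrow> \<exists>v\<in>U - S. X \<inter> star_edges v S = star_edges v T"
  shows "ext_prop s (edge_set_graph U X)"
  unfolding ext_prop_def
proof (intro conjI allI impI)
  fix S T assume "S \<subseteq> verts (edge_set_graph U X)" "card S = s" "T \<subseteq> S"
  then have ST: "S \<subseteq> U" "card S = s" "T \<subseteq> S" by (simp_all add: edge_set_graph_def)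
  from star[OF this] obtain v where v: "v \<in> U - S" "X \<inter> star_edges v S = star_edges v T" by blast
  have "{v, u} \<in> X \<longleftrightarrow> u \<in> T" if "u \<in> S" for u
  proof -
    have "{v, u} \<in> X \<longleftrightarrow> {v, u} \<in> X \<inter> star_edges v S" using that by (simp add: star_edges_def)
    also have "\<dots> \<longleftrightarrow> u \<in> T" unfolding v(2) by (auto simp: star_edges_def doubleton_eq_iff)
    finally show ?thesis .
  qed
  then show "\<exists>z\<in>verts (edge_set_graph U X). z \<notin> S \<and> (\<forall>t\<in>T. adj (edge_set_graph U X) z t) \<and>
      (\<forall>u\<in>S - T. \<not> adj (edge_set_graph U X) z u)"
    using v(1) ST by (intro bexI[of _ v]) (auto simp: edge_set_graph_def)
qed (use assms(1) in \<open>simp add: edge_set_graph_def\<close>)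

lemma ex_count_dominated:
  "\<exists>n::nat. (n + s) ^ s * 2 ^ s * (2 ^ s - 1) ^ n < (2 ^ s) ^ n"
proof (cases "s = 0")
  case True
  then show ?thesis by (intro exI[of _ 1]) simp
next
  case False
  define \<rho> :: real where "\<rho> = (2 ^ s - 1) / 2 ^ s"
  have "(1::real) < 2 ^ s" using False by simp
  then have "0 < \<rho>" "\<rho> < 1" by (simp_all add: \<rho>_def)
  then have "eventually (\<lambda>n. real (n + s) ^ s * 2 ^ s * \<rho> ^ n < 1) sequentially" by real_asymp
  then obtain n where "real (n + s) ^ s * 2 ^ s * \<rho> ^ n < 1" by (auto simp: eventually_sequentially)
  then have "real (n + s) ^ s * 2 ^ s * (2 ^ s - 1) ^ n < (2 ^ s) ^ n"
    by (simp add: \<rho>_def power_divide field_simps)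
  then have "real ((n + s) ^ s * 2 ^ s * (2 ^ s - 1) ^ n) < real ((2 ^ s) ^ n)" by (simp add: of_nat_diff)
  then show ?thesis using of_nat_less_iff by blast
qed

lemma card_subsets_with_subset_le:
  assumes "finite U" "s \<le> card U"
  shows "card (SIGMA S : {S. S \<subseteq> U \<and> card S = s}. Pow S) \<le> card U ^ s * 2 ^ s"
proof -
  have "card (SIGMA S : {S. S \<subseteq> U \<and> card S = s}. Pow S) = (\<Sum>S | S \<subseteq> U \<and> card S = s. card (Pow S))"
    using assms(1) by (intro card_SigmaI) (auto intro: finite_subset)
  also have "\<dots> = (\<Sum>S | S \<subseteq> U \<and> card S = s. 2 ^ s)"
  proof (rule sum.cong[OF refl])
    fix S assume "S \<in> {S. S \<subseteq> U \<and> card S = s}"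
    then have "finite S" "card S = s" using assms(1) finite_subset by auto
    then show "card (Pow S) = 2 ^ s" by (simp add: card_Pow)
  qed
  also have "\<dots> = (card U choose s) * 2 ^ s" by (simp add: n_subsets[OF assms(1)])
  also have "\<dots> \<le> card U ^ s * 2 ^ s" using binomial_le_pow[OF assms(2)] by simp
  finally show ?thesis .
qed

lemma card_star_avoiding_le:
  assumes "finite U" and S: "S \<subseteq> U" "card S = s" "T \<subseteq> S" and E: "E = {e. e \<subseteq> U \<and> card e = 2}"
  shows "card {X. X \<subseteq> E \<and> (\<forall>v\<in>U - S. X \<inter> star_edges v S \<noteq> star_edges v T)} * 2 ^ (s * (card U - s))
    \<le> 2 ^ card E * (2 ^ s - 1) ^ (card U - s)"
proof -
  have "finite S" using \<open>finite U\<close> S(1) finite_subset by blast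
  then have card_Diff: "card (U - S) = card U - s" using card_Diff_subset[OF _ S(1)] S(2) by simp
  have "disjoint_family_on (\<lambda>v. star_edges v S) (U - S)"
    by (auto simp: disjoint_family_on_def star_edges_def doubleton_eq_iff)
  moreover have "star_edges v S \<subseteq> E \<and> card (star_edges v S) = s \<and> star_edges v T \<subseteq> star_edges v S"
    if "v \<in> U - S" for v
    using that S card_star_edges[of v S] by (auto simp: star_edges_def E card_insert_if)
  ultimately show ?thesis
    unfolding card_Diff[symmetric] using \<open>finite U\<close> by (intro card_avoid_patterns_le) (auto simp: E)
qed

theorem ext_prop_graph_exists: "\<exists>G. is_graph G \<and> ext_prop s G"
proof -
  obtain n where n: "(n + s) ^ s * 2 ^ s * (2 ^ s - 1) ^ n < (2 ^ s) ^ n" using ex_count_dominated by blast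
  define U where "U = {..<n + s}"
  define E where "E = {e. e \<subseteq> U \<and> card e = 2}"
  define patterns where "patterns = (SIGMA S : {S. S \<subseteq> U \<and> card S = s}. Pow S)"
  define bad where "bad = (\<lambda>(S, T). {X. X \<subseteq> E \<and> (\<forall>v\<in>U - S. X \<inter> star_edges v S \<noteq> star_edges v T)})"
  have U: "finite U" "card U = n + s" by (simp_all add: U_def)
  have "finite E" using U(1) by (simp add: E_def)
  have "finite patterns"
    unfolding patterns_def using U(1) by (intro finite_SigmaI) (auto intro: finite_subset)
  have card_bad: "card (bad p) * 2 ^ (s * n) \<le> 2 ^ card E * (2 ^ s - 1) ^ n" if p: "p \<in> patterns" for p
  proof -
    obtain S T where "p = (S, T)" "S \<subseteq> U" "card S = s" "T \<subseteq> S" using p by (auto simp: patterns_def)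
    then show ?thesis using card_star_avoiding_le[OF U(1) _ _ _ E_def, of S s T] by (simp add: bad_def U(2))
  qed
  have "card (\<Union>p\<in>patterns. bad p) * 2 ^ (s * n) \<le> (\<Sum>p\<in>patterns. card (bad p)) * 2 ^ (s * n)"
    using card_UN_le[OF \<open>finite patterns\<close>] by (rule mult_right_mono) simp
  also have "\<dots> \<le> card patterns * (2 ^ card E * (2 ^ s - 1) ^ n)"
    unfolding sum_distrib_right using sum_bounded_above[OF card_bad] by simp
  also have "\<dots> \<le> (n + s) ^ s * 2 ^ s * (2 ^ card E * (2 ^ s - 1) ^ n)"
    using card_subsets_with_subset_le[OF U(1), of s] unfolding patterns_def U(2)
    by (intro mult_right_mono) simp_all
  also have "\<dots> < 2 ^ card E * 2 ^ (s * n)" using n by (simp add: power_mult)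
  finally have "card (\<Union>p\<in>patterns. bad p) < card (Pow E)" using \<open>finite E\<close> by (simp add: card_Pow)
  moreover have "finite (\<Union>p\<in>patterns. bad p)"
    using \<open>finite patterns\<close> \<open>finite E\<close> by (auto simp: bad_def)
  ultimately have "\<not> Pow E \<subseteq> (\<Union>p\<in>patterns. bad p)" using card_mono not_less by blast
  then obtain X where X: "X \<subseteq> E" "\<And>p. p \<in> patterns \<Longrightarrow> X \<notin> bad p" by blast
  have "ext_prop s (edge_set_graph U X)"
  proof (rule ext_prop_edge_set_graph)
    fix S T assume "S \<subseteq> U" "card S = s" "T \<subseteq> S"
    then have "X \<notin> bad (S, T)" by (intro X(2)) (simp add: patterns_def)
    then show "\<exists>v\<in>U - S. X \<inter> star_edges v S = star_edges v T" using X(1) by (simp add: bad_def)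
  qed (simp add: U)
  then show ?thesis using is_graph_edge_set_graph[OF U(1)] by blast
qed

section \<open>Generic blow-ups\<close>

lemma ex_surj_Pow:
  assumes "finite A" "finite B" "B \<noteq> {}" "card B \<le> card A"
  obtains h where "h ` Pow A = B"
proof -
  have "card A \<le> card (Pow A)" using less_exp[of "card A"] \<open>finite A\<close> by (simp add: card_Pow)
  then have "card B \<le> card (Pow A)" using assms(4) by simp
  then have "\<exists>f. inj_on f B \<and> f ` B \<subseteq> Pow A"
    using inj_on_iff_card_le[OF \<open>finite B\<close>] \<open>finite A\<close> by blast
  then show thesis using inj_on_iff_surj[OF \<open>B \<noteq> {}\<close>] that by metis
qed

text \<open>The colour of a vertex is read off its neighbourhood in a reserved set \<open>C\<close>.\<close>

lemma generic_coloured_graph_exists: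
  assumes "finite \<Lambda>" "\<Lambda> \<noteq> {}"
  obtains G col where "is_graph G" "col ` verts G \<subseteq> \<Lambda>"
    "\<And>c S \<pi>. c \<in> \<Lambda> \<Longrightarrow> S \<subseteq> verts G \<Longrightarrow> card S \<le> q \<Longrightarrow>
      \<exists>v\<in>verts G - S. col v = c \<and> (\<forall>u\<in>S. adj G v u \<longleftrightarrow> \<pi> u)"
proof -
  obtain G where "is_graph G" "ext_prop (card \<Lambda> + q) G" using ext_prop_graph_exists by blast
  then interpret ext_graph G "card \<Lambda> + q" by unfold_locales
  have "card \<Lambda> + q \<le> card (verts G)" using ext by (simp add: ext_prop_def)
  then have "card \<Lambda> \<le> card (verts G)" by simp
  then obtain C where C: "C \<subseteq> verts G" "card C = card \<Lambda>" by (rule obtain_subset_with_card_n)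
  have "finite C" using C(1) finite_verts finite_subset by blast
  then obtain h where h: "h ` Pow C = \<Lambda>" using ex_surj_Pow[OF _ assms, of C] C(2) by auto
  define G' where "G' = \<lparr>verts = verts G - C, adj = \<lambda>u v. u \<notin> C \<and> v \<notin> C \<and> adj G u v\<rparr>"
  define col where "col v = h {c \<in> C. adj G v c}" for v
  show thesis
  proof (rule that)
    show "is_graph G'" using graph by (auto simp: is_graph_def G'_def)
    show "col ` verts G' \<subseteq> \<Lambda>" unfolding h[symmetric] by (auto simp: col_def)
    fix c S \<pi> assume "c \<in> \<Lambda>" and S: "S \<subseteq> verts G'" "card S \<le> q"
    then obtain C' where C': "C' \<subseteq> C" "c = h C'" using h by blast
    have "S \<union> C \<subseteq> verts G" using S(1) C(1) by (auto simp: G'_def)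
    moreover have "card (S \<union> C) \<le> card \<Lambda> + q" using card_Un_le[of S C] S(2) C(2) by simp
    ultimately have "\<exists>v\<in>verts G - (S \<union> C). \<forall>u\<in>S \<union> C. adj G v u \<longleftrightarrow> (if u \<in> C then u \<in> C' else \<pi> u)"
      by (rule ext_witness)
    then obtain v where v: "v \<in> verts G - (S \<union> C)"
      and adj_v: "\<forall>u\<in>S \<union> C. adj G v u \<longleftrightarrow> (if u \<in> C then u \<in> C' else \<pi> u)" by blast
    have "{c \<in> C. adj G v c} = C'" using adj_v C'(1) by auto
    then have "col v = c" by (simp add: col_def C'(2))
    moreover have "\<forall>u\<in>S. adj G' v u \<longleftrightarrow> \<pi> u" using adj_v v S(1) by (auto simp: G'_def)
    ultimately show "\<exists>v\<in>verts G' - S. col v = c \<and> (\<forall>u\<in>S. adj G' v u \<longleftrightarrow> \<pi> u)"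
      using v by (auto simp: G'_def)
  qed
qed

text \<open>The bound on \<open>S\<close> is the number of classes, which bounds the size of every clique.\<close>

locale generic_blowup =
  fixes G Q :: graph and s :: nat and base copy :: "nat \<Rightarrow> nat"
  assumes graph: "is_graph G" and graph_Q: "is_graph Q" and verts_Q: "verts Q \<noteq> {}"
    and base: "v \<in> verts G \<Longrightarrow> base v \<in> verts Q" and copy: "v \<in> verts G \<Longrightarrow> copy v \<le> s"
    and adj_same_copy: "u \<in> verts G \<Longrightarrow> v \<in> verts G \<Longrightarrow> copy u = copy v \<Longrightarrow> adj G u v \<longleftrightarrow> adj Q (base u) (base v)"
    and generic: "a \<in> verts Q \<Longrightarrow> k \<le> s \<Longrightarrow> S \<subseteq> verts G \<Longrightarrow> card S \<le> card (verts Q \<times> {..s}) \<Longrightarrow>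
      \<exists>v\<in>verts G - S. base v = a \<and> copy v = k \<and> (\<forall>u\<in>S. copy u \<noteq> k \<longrightarrow> (adj G v u \<longleftrightarrow> \<pi> u))"

lemma generic_blowup_exists:
  assumes Q: "is_graph Q" "verts Q \<noteq> {}"
  obtains G base copy where "generic_blowup G Q s base copy"
proof -
  have "finite (verts Q \<times> {..s})" "verts Q \<times> {..s} \<noteq> {}" using Q is_graph_finite by auto
  then obtain H col where H: "is_graph H" and col: "col ` verts H \<subseteq> verts Q \<times> {..s}"
    and generic: "\<And>c S \<pi>. c \<in> verts Q \<times> {..s} \<Longrightarrow> S \<subseteq> verts H \<Longrightarrow> card S \<le> card (verts Q \<times> {..s}) \<Longrightarrow>
      \<exists>v\<in>verts H - S. col v = c \<and> (\<forall>u\<in>S. adj H v u \<longleftrightarrow> \<pi> u)"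
    by (rule generic_coloured_graph_exists) (rule that)
  define base copy where "base = fst \<circ> col" and "copy = snd \<circ> col"
  define G where "G = \<lparr>verts = verts H, adj = \<lambda>u v. u \<in> verts H \<and> v \<in> verts H \<and>
    (if copy u = copy v then adj Q (base u) (base v) else adj H u v)\<rparr>"
  have "generic_blowup G Q s base copy"
  proof
    show "is_graph G"
      using H Q(1) unfolding is_graph_def by (auto simp: G_def)
    show "base v \<in> verts Q" "copy v \<le> s" if "v \<in> verts G" for v
      using that col by (auto simp: G_def base_def copy_def)
    show "adj G u v \<longleftrightarrow> adj Q (base u) (base v)"
      if "u \<in> verts G" "v \<in> verts G" "copy u = copy v" for u v
      using that by (simp add: G_def)
    fix a k S \<pi> assume "a \<in> verts Q" "k \<le> s" and S: "S \<subseteq> verts G" "card S \<le> card (verts Q \<times> {..s})"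
    then have "(a, k) \<in> verts Q \<times> {..s}" "S \<subseteq> verts H" by (auto simp: G_def)
    from generic[OF this S(2), of \<pi>] obtain v
      where v: "v \<in> verts H - S" "col v = (a, k)" "\<forall>u\<in>S. adj H v u \<longleftrightarrow> \<pi> u" by blast
    then show "\<exists>v\<in>verts G - S. base v = a \<and> copy v = k \<and> (\<forall>u\<in>S. copy u \<noteq> k \<longrightarrow> (adj G v u \<longleftrightarrow> \<pi> u))"
      using S(1) by (intro bexI[of _ v]) (auto simp: G_def base_def copy_def)
  qed (use Q in auto)
  then show thesis by (rule that)
qed

definition totally_dominating :: "graph \<Rightarrow> nat set \<Rightarrow> bool" where
  "totally_dominating Q J \<longleftrightarrow> (\<forall>a\<in>verts Q. \<exists>x\<in>J. adj Q a x)"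

definition no_dominating_clique :: "graph \<Rightarrow> bool" where
  "no_dominating_clique Q \<longleftrightarrow> (\<forall>J\<subseteq>verts Q. cl Q J \<longrightarrow> \<not> totally_dominating Q J)"

definition maximal_cliques_dominate :: "graph \<Rightarrow> bool" where
  "maximal_cliques_dominate Q \<longleftrightarrow> (\<forall>J\<subseteq>verts Q. maxcl Q J \<longrightarrow> totally_dominating Q J)"

definition dominating_cliques_maximal :: "graph \<Rightarrow> bool" where
  "dominating_cliques_maximal Q \<longleftrightarrow> (\<forall>J\<subseteq>verts Q. cl Q J \<and> totally_dominating Q J \<longrightarrow> maxcl Q J)"

context generic_blowup
begin

definition slice :: "nat set \<Rightarrow> nat \<Rightarrow> nat set" where
  "slice Z k = base ` {z \<in> Z. copy z = k}"

lemma ext_prop_blowup: "ext_prop s G"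
  unfolding ext_prop_def
proof (intro conjI allI impI)
  obtain a where a: "a \<in> verts Q" using verts_Q by blast
  have s_le: "s \<le> card (verts Q \<times> {..s})"
  proof -
    have "1 \<le> card (verts Q)" using a is_graph_finite[OF graph_Q] by (simp add: Suc_le_eq card_gt_0_iff verts_Q)
    then have "1 * s \<le> card (verts Q) * Suc s" by (intro mult_le_mono) simp_all
    then show ?thesis by (simp add: card_cartesian_product)
  qed
  show "s \<le> card (verts G)"
  proof (rule ccontr)
    assume "\<not> s \<le> card (verts G)"
    then show False using generic[OF a, of 0 "verts G"] s_le by auto
  qed
  fix S T assume S: "S \<subseteq> verts G" "card S = s" "T \<subseteq> S"
  have "finite S" using S(1) is_graph_finite[OF graph] finite_subset by blast
  have "\<not> {..s} \<subseteq> copy ` S"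
  proof
    assume "{..s} \<subseteq> copy ` S"
    then have "card {..s} \<le> card S" using \<open>finite S\<close> surj_card_le by blast
    then show False using S(2) by simp
  qed
  then obtain k where k: "k \<le> s" "k \<notin> copy ` S" by blast
  then obtain v where v: "v \<in> verts G - S" "\<forall>u\<in>S. copy u \<noteq> k \<longrightarrow> (adj G v u \<longleftrightarrow> u \<in> T)"
    using generic[OF a _ S(1), of k "\<lambda>u. u \<in> T"] S(2) s_le by auto
  have "adj G v u \<longleftrightarrow> u \<in> T" if "u \<in> S" for u
  proof -
    have "copy u \<noteq> k" using k(2) that by blast
    then show ?thesis using v(2) that by simp
  qed
  with v(1) S(3) show "\<exists>z\<in>verts G. z \<notin> S \<and> (\<forall>t\<in>T. adj G z t) \<and> (\<forall>u\<in>S - T. \<not> adj G z u)"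
    by (intro bexI[of _ v]) auto
qed

lemma slice_subset: "Z \<subseteq> verts G \<Longrightarrow> slice Z k \<subseteq> verts Q"
  using base by (auto simp: slice_def)

lemma cl_slice:
  assumes "Z \<subseteq> verts G" "cl G Z"
  shows "cl Q (slice Z k)"
  unfolding cl_def
proof (intro ballI impI)
  fix x y assume "x \<in> slice Z k" "y \<in> slice Z k" "x \<noteq> y"
  then obtain u v where uv: "u \<in> Z" "copy u = k" "x = base u" "v \<in> Z" "copy v = k" "y = base v"
    unfolding slice_def by blast
  have "u \<noteq> v" using uv(3,6) \<open>x \<noteq> y\<close> by blast
  then have "adj G u v" using assms(2) uv(1,4) by (simp add: cl_def)
  moreover have "u \<in> verts G" "v \<in> verts G" using uv(1,4) assms(1) by auto
  ultimately show "adj Q x y" using adj_same_copy[of u v] uv(2,3,5,6) by simp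
qed

lemma card_clique_le:
  assumes Z: "Z \<subseteq> verts G" "cl G Z"
  shows "card Z \<le> card (verts Q \<times> {..s})"
proof (rule card_inj_on_le)
  show "inj_on (\<lambda>v. (base v, copy v)) Z"
  proof (rule inj_onI, rule ccontr)
    fix u v assume uv: "u \<in> Z" "v \<in> Z" "(base u, copy u) = (base v, copy v)" "u \<noteq> v"
    then have "adj Q (base u) (base v)" using Z adj_same_copy[of u v] unfolding cl_def by auto
    then show False using uv(3) is_graph_irrefl[OF graph_Q] by simp
  qed
  show "(\<lambda>v. (base v, copy v)) ` Z \<subseteq> verts Q \<times> {..s}" using base copy Z(1) by auto
  show "finite (verts Q \<times> {..s})" using is_graph_finite[OF graph_Q] by simp
qed

lemma ball_slice_adj_iff:
  assumes "z \<in> verts G" "Z \<subseteq> verts G"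
  shows "(\<forall>x\<in>slice Z (copy z). adj Q (base z) x \<longleftrightarrow> c) \<longleftrightarrow> (\<forall>u\<in>Z. copy u = copy z \<longrightarrow> (adj G z u \<longleftrightarrow> c))"
proof -
  have "adj G z u \<longleftrightarrow> adj Q (base z) (base u)" if "u \<in> Z" "copy u = copy z" for u
    using adj_same_copy[OF assms(1), of u] that assms(2) by auto
  then show ?thesis by (auto simp: slice_def)
qed

lemma mem_outer_colours_iff_slices:
  assumes Z: "Z \<subseteq> verts G" "cl G Z"
  shows "c \<in> outer_colours G Z \<longleftrightarrow> (\<exists>k\<le>s. \<exists>a\<in>verts Q. \<forall>x\<in>slice Z k. adj Q a x \<longleftrightarrow> c)"
proof
  assume "c \<in> outer_colours G Z"
  then obtain z where z: "z \<in> verts G" "\<forall>x\<in>Z. adj G z x \<longleftrightarrow> c" by (auto simp: outer_colours_def)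
  then have "\<forall>x\<in>slice Z (copy z). adj Q (base z) x \<longleftrightarrow> c" using ball_slice_adj_iff[OF z(1) Z(1)] by blast
  then show "\<exists>k\<le>s. \<exists>a\<in>verts Q. \<forall>x\<in>slice Z k. adj Q a x \<longleftrightarrow> c" using base[OF z(1)] copy[OF z(1)] by blast
next
  assume "\<exists>k\<le>s. \<exists>a\<in>verts Q. \<forall>x\<in>slice Z k. adj Q a x \<longleftrightarrow> c"
  then obtain k a where k: "k \<le> s" and a: "a \<in> verts Q" "\<forall>x\<in>slice Z k. adj Q a x \<longleftrightarrow> c" by blast
  obtain v where v: "v \<in> verts G - Z" "base v = a" "copy v = k" "\<forall>u\<in>Z. copy u \<noteq> k \<longrightarrow> (adj G v u \<longleftrightarrow> c)"
    using generic[OF a(1) k Z(1) card_clique_le[OF Z], of "\<lambda>_. c"] by blast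
  then have "\<forall>u\<in>Z. copy u = k \<longrightarrow> (adj G v u \<longleftrightarrow> c)" using ball_slice_adj_iff[of v Z c] a(2) Z(1) by simp
  with v show "c \<in> outer_colours G Z" unfolding outer_colours_def by blast
qed

lemma phiC_iff_slices:
  assumes "Z \<subseteq> verts G" "cl G Z"
  shows "phiC G Z \<longleftrightarrow> (\<exists>k\<le>s. \<not> totally_dominating Q (slice Z k))"
  by (simp add: phiC_iff_outer_colours mem_outer_colours_iff_slices[OF assms] totally_dominating_def)

lemma phiI_iff_slices:
  assumes "Z \<subseteq> verts G" "cl G Z"
  shows "phiI G Z \<longleftrightarrow> (\<exists>k\<le>s. phiI Q (slice Z k))"
proof -
  have "phiI Q J \<longleftrightarrow> (\<exists>a\<in>verts Q. \<forall>x\<in>J. adj Q a x)" for J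
    using is_graph_irrefl[OF graph_Q] unfolding phiI_def by blast
  then show ?thesis by (simp add: phiI_iff_outer_colours[of G] mem_outer_colours_iff_slices[OF assms])
qed

lemma ex_clique_with_classes:
  assumes "cl Q J" "J \<subseteq> verts Q" "finite R" "R \<subseteq> J \<times> {..s}"
  shows "\<exists>Z\<subseteq>verts G. cl G Z \<and> (\<lambda>v. (base v, copy v)) ` Z = R"
  using assms(3,4)
proof (induction R)
  case empty
  show ?case by (intro exI[of _ "{}"]) (simp add: cl_def)
next
  case (insert r R)
  then obtain Z where Z: "Z \<subseteq> verts G" "cl G Z" "(\<lambda>v. (base v, copy v)) ` Z = R" by auto
  obtain a k where r: "r = (a, k)" "a \<in> J" "k \<le> s" using insert.prems by auto
  then have "a \<in> verts Q" using assms(2) by blast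
  then obtain v where v: "v \<in> verts G - Z" "base v = a" "copy v = k" "\<forall>u\<in>Z. copy u \<noteq> k \<longrightarrow> adj G v u"
    using generic[OF _ r(3) Z(1) card_clique_le[OF Z(1,2)], of a "\<lambda>_. True"] by auto
  have adj_v: "adj G v u" if "u \<in> Z" for u
  proof (cases "copy u = k")
    case True
    have "(base u, copy u) \<in> R" using that Z(3) by blast
    then have "base u \<in> J" "a \<noteq> base u" using insert.prems insert.hyps(2) True unfolding r(1) by auto
    then have "adj Q a (base u)" using assms(1) r(2) by (simp add: cl_def)
    moreover have "u \<in> verts G" using that Z(1) by blast
    ultimately show ?thesis using adj_same_copy[of v u] v(1-3) True by simp
  qed (use v(4) that in blast)
  have "cl G (insert v Z)"
    using Z(2) adj_v unfolding cl_iff_monochromatic by (intro monochromatic_insert[OF graph]) simp_all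
  moreover have "(\<lambda>v. (base v, copy v)) ` insert v Z = insert r R" using Z(3) v(2,3) r(1) by simp
  ultimately show ?case using Z(1) v(1) by (intro exI[of _ "insert v Z"]) simp
qed

lemma ex_clique_lift:
  assumes "J \<subseteq> verts Q" "cl Q J"
  obtains Z where "Z \<subseteq> verts G" "cl G Z" "phiC G Z \<longleftrightarrow> \<not> totally_dominating Q J" "phiI G Z \<longleftrightarrow> phiI Q J"
proof -
  have "finite (J \<times> {..s})" using assms(1) is_graph_finite[OF graph_Q] finite_subset by auto
  from ex_clique_with_classes[OF assms(2,1) this order_refl]
  obtain Z where Z: "Z \<subseteq> verts G" "cl G Z" "(\<lambda>v. (base v, copy v)) ` Z = J \<times> {..s}" by auto
  have slice: "slice Z k = J" if "k \<le> s" for k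
  proof -
    have "slice Z k = {a. (a, k) \<in> (\<lambda>v. (base v, copy v)) ` Z}" by (auto simp: slice_def)
    then show ?thesis using that by (simp add: Z(3))
  qed
  show thesis
  proof (rule that[OF Z(1,2)])
    show "phiC G Z \<longleftrightarrow> \<not> totally_dominating Q J" using phiC_iff_slices[OF Z(1,2)] slice by auto
    show "phiI G Z \<longleftrightarrow> phiI Q J" using phiI_iff_slices[OF Z(1,2)] slice by auto
  qed
qed

lemma ball_cliques_lift:
  assumes "\<And>Z. Z \<subseteq> verts G \<Longrightarrow> cl G Z \<Longrightarrow> R (phiC G Z) (phiI G Z)" "J \<subseteq> verts Q" "cl Q J"
  shows "R (\<not> totally_dominating Q J) (phiI Q J)"
proof -
  obtain Z where Z: "Z \<subseteq> verts G" "cl G Z" "phiC G Z \<longleftrightarrow> \<not> totally_dominating Q J" "phiI G Z \<longleftrightarrow> phiI Q J"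
    using ex_clique_lift[OF assms(2,3)] .
  then show ?thesis using assms(1)[OF Z(1,2)] by simp
qed

lemma phiC1_iff_base: "phiC1 G \<longleftrightarrow> no_dominating_clique Q"
proof
  assume "phiC1 G"
  then show "no_dominating_clique Q"
    using ball_cliques_lift[of "\<lambda>c i. c"] by (simp add: phiC1_def no_dominating_clique_def)
next
  assume base: "no_dominating_clique Q"
  show "phiC1 G"
    unfolding phiC1_def
  proof (intro allI impI)
    fix Z assume Z: "Z \<subseteq> verts G" "cl G Z"
    then have "\<not> totally_dominating Q (slice Z 0)" using base slice_subset cl_slice by (simp add: no_dominating_clique_def)
    then show "phiC G Z" using phiC_iff_slices[OF Z] by blast
  qed
qed

lemma phiC2_iff_base:
  "phiC2 G \<longleftrightarrow> maximal_cliques_dominate Q"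
proof
  assume "phiC2 G"
  then show "maximal_cliques_dominate Q"
    using ball_cliques_lift[of "\<lambda>c i. \<not> i \<longrightarrow> \<not> c"] by (simp add: phiC2_def maxcl_iff_not_phiI
        maximal_cliques_dominate_def)
next
  assume base: "maximal_cliques_dominate Q"
  show "phiC2 G"
    unfolding phiC2_def
  proof (intro allI impI)
    fix Z assume Z: "Z \<subseteq> verts G" "maxcl G Z"
    then have "cl G Z" by (simp add: maxcl_iff_not_phiI)
    then have "maxcl Q (slice Z k)" if "k \<le> s" for k
      using that Z phiI_iff_slices[of Z] cl_slice by (auto simp: maxcl_iff_not_phiI)
    then have "totally_dominating Q (slice Z k)" if "k \<le> s" for k
      using that base slice_subset[OF Z(1)] by (simp add: maximal_cliques_dominate_def)
    then show "\<not> phiC G Z" using phiC_iff_slices[OF Z(1) \<open>cl G Z\<close>] by simp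
  qed
qed

lemma phiC3_iff_base:
  "phiC3 G \<longleftrightarrow> dominating_cliques_maximal Q"
proof
  assume "phiC3 G"
  then show "dominating_cliques_maximal Q"
    using ball_cliques_lift[of "\<lambda>c i. \<not> c \<longrightarrow> \<not> i"] by (simp add: phiC3_def maxcl_iff_not_phiI
        dominating_cliques_maximal_def)
next
  assume base: "dominating_cliques_maximal Q"
  show "phiC3 G"
    unfolding phiC3_def
  proof (intro allI impI)
    fix Z assume Z: "Z \<subseteq> verts G" and "cl G Z \<and> \<not> phiC G Z"
    then have "cl G Z" "totally_dominating Q (slice Z k)" if "k \<le> s" for k
      using that phiC_iff_slices[OF Z] by auto
    then have "\<not> phiI Q (slice Z k)" if "k \<le> s" for k
      using that base slice_subset[OF Z] cl_slice[OF Z]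
      by (simp add: dominating_cliques_maximal_def maxcl_iff_not_phiI)
    then show "maxcl G Z" using \<open>cl G Z \<and> \<not> phiC G Z\<close> phiI_iff_slices[OF Z] by (simp add: maxcl_iff_not_phiI)
  qed
qed

end

section \<open>Complements\<close>

definition gcompl :: "graph \<Rightarrow> graph" where
  "gcompl G = \<lparr>verts = verts G,
     adj = \<lambda>u v. u \<in> verts G \<and> v \<in> verts G \<and> u \<noteq> v \<and> \<not> adj G u v\<rparr>"

lemma verts_gcompl [simp]: "verts (gcompl G) = verts G"
  by (simp add: gcompl_def)

lemma adj_gcompl: "u \<in> verts G \<Longrightarrow> v \<in> verts G \<Longrightarrow> adj (gcompl G) u v \<longleftrightarrow> u \<noteq> v \<and> \<not> adj G u v"
  by (simp add: gcompl_def)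

lemma is_graph_gcompl: "is_graph G \<Longrightarrow> is_graph (gcompl G)"
  unfolding is_graph_def by (auto simp: gcompl_def)

lemma ext_prop_gcompl:
  assumes "ext_prop s G"
  shows "ext_prop s (gcompl G)"
  unfolding ext_prop_def verts_gcompl
proof (intro conjI allI impI)
  show "s \<le> card (verts G)" using assms by (simp add: ext_prop_def)
  fix S T assume S: "S \<subseteq> verts G" "card S = s" "T \<subseteq> S"
  have "S - T \<subseteq> S" by blast
  then obtain z where "z \<in> verts G" "z \<notin> S" "\<forall>t\<in>S - T. adj G z t" "\<forall>u\<in>S - (S - T). \<not> adj G z u"
    using assms S(1,2) unfolding ext_prop_def by blast
  with S show "\<exists>z\<in>verts G. z \<notin> S \<and> (\<forall>t\<in>T. adj (gcompl G) z t) \<and> (\<forall>u\<in>S - T. \<not> adj (gcompl G) z u)"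
    by (intro bexI[of _ z]) (auto simp: gcompl_def)
qed

lemma monochromatic_gcompl:
  "X \<subseteq> verts G \<Longrightarrow> monochromatic (gcompl G) c X \<longleftrightarrow> monochromatic G (\<not> c) X"
  unfolding monochromatic_def by (intro ball_cong refl) (auto simp: adj_gcompl subset_iff)

lemma mem_outer_colours_gcompl:
  "X \<subseteq> verts G \<Longrightarrow> c \<in> outer_colours (gcompl G) X \<longleftrightarrow> (\<not> c) \<in> outer_colours G X"
  unfolding outer_colours_def by (auto simp: adj_gcompl subset_iff intro!: bex_cong)

lemma phiI123_gcompl:
  assumes "is_graph G"
  shows "phiI1 (gcompl G) \<longleftrightarrow> phiC1 G" "phiI2 (gcompl G) \<longleftrightarrow> phiC2 G" "phiI3 (gcompl G) \<longleftrightarrow> phiC3 G"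
proof -
  note is_graph_gcompl[OF assms]
  then have "ind (gcompl G) X \<longleftrightarrow> cl G X" if "X \<subseteq> verts G" for X
    using that by (simp add: ind_iff_monochromatic cl_iff_monochromatic monochromatic_gcompl)
  moreover have "phiC (gcompl G) X \<longleftrightarrow> phiI G X" "phiI (gcompl G) X \<longleftrightarrow> phiC G X" if "X \<subseteq> verts G" for X
    using that by (simp_all add: phiC_iff_outer_colours phiI_iff_outer_colours mem_outer_colours_gcompl)
  ultimately show "phiI1 (gcompl G) \<longleftrightarrow> phiC1 G" "phiI2 (gcompl G) \<longleftrightarrow> phiC2 G" "phiI3 (gcompl G) \<longleftrightarrow> phiC3 G"
    by (simp_all add: phiI1_def phiC1_def phiI2_def phiC2_def phiI3_def phiC3_def
        maxind_iff_not_phiC maxcl_iff_not_phiI cong: imp_cong)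
qed

section \<open>The five behaviours of cliques\<close>

lemma realize_by_blowup:
  fixes \<Phi> :: "bool \<Rightarrow> bool \<Rightarrow> bool \<Rightarrow> bool"
  assumes Q: "is_graph Q" "verts Q \<noteq> {}"
    and \<Phi>: "\<Phi> (no_dominating_clique Q) (maximal_cliques_dominate Q) (dominating_cliques_maximal Q)"
  shows "\<exists>G. is_graph G \<and> ext_prop s G \<and> \<Phi> (phiC1 G) (phiC2 G) (phiC3 G)"
    and "\<exists>G. is_graph G \<and> ext_prop s G \<and> \<Phi> (phiI1 G) (phiI2 G) (phiI3 G)"
proof -
  obtain G base copy where "generic_blowup G Q s base copy" using generic_blowup_exists[OF Q] .
  then interpret generic_blowup G Q s base copy .
  have "\<Phi> (phiC1 G) (phiC2 G) (phiC3 G)" using \<Phi> unfolding phiC1_iff_base phiC2_iff_base phiC3_iff_base .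
  then show "\<exists>G. is_graph G \<and> ext_prop s G \<and> \<Phi> (phiC1 G) (phiC2 G) (phiC3 G)"
    using graph ext_prop_blowup by blast
  have "\<Phi> (phiI1 (gcompl G)) (phiI2 (gcompl G)) (phiI3 (gcompl G))"
    using \<open>\<Phi> (phiC1 G) (phiC2 G) (phiC3 G)\<close> by (simp add: phiI123_gcompl[OF graph])
  then show "\<exists>G. is_graph G \<and> ext_prop s G \<and> \<Phi> (phiI1 G) (phiI2 G) (phiI3 G)"
    using is_graph_gcompl[OF graph] ext_prop_gcompl[OF ext_prop_blowup] by blast
qed

definition bull_on :: "nat set \<Rightarrow> graph" where
  "bull_on A = edge_set_graph A {{0, 1}, {1, 2}, {2, 3}, {1, 4}, {2, 4}}"

lemma verts_bull_on: "verts (bull_on A) = A"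
  by (simp add: bull_on_def edge_set_graph_def)

lemma adj_bull_on: "adj (bull_on A) u v \<longleftrightarrow> u \<in> A \<and> v \<in> A \<and>
    {u, v} \<in> {{0, 1}, {1, 2}, {2, 3}, {1, 4}, {2, 4}}"
  by (auto simp: bull_on_def edge_set_graph_def doubleton_eq_iff)

lemma is_graph_bull_on: "finite A \<Longrightarrow> is_graph (bull_on A)"
  unfolding bull_on_def by (rule is_graph_edge_set_graph)

lemma bull_on_central_edge:
  assumes "{1, 2} \<subseteq> A" "A \<subseteq> {..4}"
  shows "cl (bull_on A) {1, 2}" "totally_dominating (bull_on A) {1, 2}"
proof -
  show "cl (bull_on A) {1, 2}" using assms(1) by (auto simp: cl_def adj_bull_on)
  show "totally_dominating (bull_on A) {1, 2}"
    unfolding totally_dominating_def verts_bull_on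
  proof
    fix a assume "a \<in> A"
    moreover from this have "a = 0 \<or> a = 1 \<or> a = 2 \<or> a = 3 \<or> a = 4" using assms(2) by auto
    ultimately show "\<exists>x\<in>{1, 2}. adj (bull_on A) a x"
      using assms(1) by (auto simp: adj_bull_on doubleton_eq_iff)
  qed
qed

lemma not_no_dominating_clique_bull_on:
  assumes "{1, 2} \<subseteq> A" "A \<subseteq> {..4}"
  shows "\<not> no_dominating_clique (bull_on A)"
  unfolding no_dominating_clique_def verts_bull_on using bull_on_central_edge[OF assms] assms(1) by blast

lemma not_dominating_cliques_maximal_bull_on:
  assumes A: "{1, 2, 4} \<subseteq> A" "A \<subseteq> {..4}"
  shows "\<not> dominating_cliques_maximal (bull_on A)"
proof -
  have "{1, 2} \<subseteq> A" using A(1) by simp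
  moreover have "\<not> maxcl (bull_on A) {1, 2}"
    using A(1) by (auto simp: maxcl_def verts_bull_on adj_bull_on doubleton_eq_iff intro!: bexI[of _ 4])
  ultimately show ?thesis
    unfolding dominating_cliques_maximal_def verts_bull_on using bull_on_central_edge[OF _ A(2)] by blast
qed

lemma not_maximal_cliques_dominate_bull_on:
  assumes "{0, 1, 3} \<subseteq> A"
  shows "\<not> maximal_cliques_dominate (bull_on A)"
proof -
  have "maxcl (bull_on A) {0, 1}"
    using assms by (auto simp: maxcl_def cl_def verts_bull_on adj_bull_on doubleton_eq_iff)
  moreover have "\<not> totally_dominating (bull_on A) {0, 1}"
    using assms by (auto simp: totally_dominating_def verts_bull_on adj_bull_on doubleton_eq_iff intro!: bexI[of _ 3])
  moreover have "{0, 1} \<subseteq> A" using assms by simp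
  ultimately show ?thesis unfolding maximal_cliques_dominate_def verts_bull_on by blast
qed

lemma maximal_cliques_dominate_bull_on:
  assumes "{1, 2} \<subseteq> A" "A \<subseteq> {1, 2, 4}"
  shows "maximal_cliques_dominate (bull_on A)"
proof -
  have complete: "adj (bull_on A) u v" if "u \<in> A" "v \<in> A" "u \<noteq> v" for u v
  proof -
    have "u = 1 \<or> u = 2 \<or> u = 4" "v = 1 \<or> v = 2 \<or> v = 4" using that(1,2) assms(2) by auto
    then show ?thesis using that by (elim disjE) (simp_all add: adj_bull_on doubleton_eq_iff)
  qed
  have "J = A" if "J \<subseteq> A" "maxcl (bull_on A) J" for J
    using that complete unfolding maxcl_def verts_bull_on by blast
  moreover have "totally_dominating (bull_on A) A"
    unfolding totally_dominating_def verts_bull_on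
  proof
    fix a assume "a \<in> A"
    then show "\<exists>x\<in>A. adj (bull_on A) a x"
      using complete[of a 1] complete[of a 2] assms(1) by (cases "a = 1") auto
  qed
  ultimately show ?thesis by (auto simp: maximal_cliques_dominate_def verts_bull_on)
qed

lemma dominating_cliques_maximal_bull_on:
  assumes "A = {1, 2} \<or> A = {0, 1, 2, 3}"
  shows "dominating_cliques_maximal (bull_on A)"
proof -
  have "maxcl (bull_on A) J" if J: "cl (bull_on A) J" "totally_dominating (bull_on A) J" for J
  proof -
    have dominated: "\<exists>x\<in>J. adj (bull_on A) a x" if "a \<in> A" for a
      using J(2) that by (simp add: totally_dominating_def verts_bull_on)
    from assms have "1 \<in> J \<and> 2 \<in> J"
    proof
      assume "A = {1, 2}"
      then show ?thesis using dominated[of 1] dominated[of 2] by (auto simp: adj_bull_on doubleton_eq_iff)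
    next
      assume "A = {0, 1, 2, 3}"
      then show ?thesis using dominated[of 0] dominated[of 3] by (auto simp: adj_bull_on doubleton_eq_iff)
    qed
    moreover have "z \<notin> A" if "adj (bull_on A) z 1" "adj (bull_on A) z 2" for z
    proof -
      have "z = 4" using that by (auto simp: adj_bull_on doubleton_eq_iff)
      then show ?thesis using assms by auto
    qed
    ultimately show ?thesis using J(1) unfolding maxcl_def verts_bull_on by blast
  qed
  then show ?thesis by (simp add: dominating_cliques_maximal_def)
qed

lemma no_dominating_clique_bull_on: "no_dominating_clique (bull_on {4})"
  by (auto simp: no_dominating_clique_def totally_dominating_def verts_bull_on adj_bull_on doubleton_eq_iff)

lemma realize_bull_on:
  assumes "finite A" "A \<noteq> {}"
    and "\<Phi> (no_dominating_clique (bull_on A)) (maximal_cliques_dominate (bull_on A)) (dominating_cliques_maximal (bull_on A))"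
  shows "\<exists>G. is_graph G \<and> ext_prop s G \<and> \<Phi> (phiC1 G) (phiC2 G) (phiC3 G)"
    and "\<exists>G. is_graph G \<and> ext_prop s G \<and> \<Phi> (phiI1 G) (phiI2 G) (phiI3 G)"
  using realize_by_blowup[of "bull_on A" \<Phi>] assms is_graph_bull_on by (simp_all add: verts_bull_on)

lemma realize_phi1:
  "\<exists>G. is_graph G \<and> ext_prop s G \<and> phiC1 G"
  "\<exists>G. is_graph G \<and> ext_prop s G \<and> phiI1 G"
  using realize_bull_on[of "{4}" "\<lambda>a b c. a"] no_dominating_clique_bull_on by simp_all

lemma realize_only_phi3:
  "\<exists>G. is_graph G \<and> ext_prop s G \<and> \<not> phiC1 G \<and> \<not> phiC2 G \<and> phiC3 G"
  "\<exists>G. is_graph G \<and> ext_prop s G \<and> \<not> phiI1 G \<and> \<not> phiI2 G \<and> phiI3 G"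
  using realize_bull_on[of "{0, 1, 2, 3}" "\<lambda>a b c. \<not> a \<and> \<not> b \<and> c"] not_no_dominating_clique_bull_on
    not_maximal_cliques_dominate_bull_on dominating_cliques_maximal_bull_on by simp_all

lemma realize_no_phi:
  "\<exists>G. is_graph G \<and> ext_prop s G \<and> \<not> phiC1 G \<and> \<not> phiC2 G \<and> \<not> phiC3 G"
  "\<exists>G. is_graph G \<and> ext_prop s G \<and> \<not> phiI1 G \<and> \<not> phiI2 G \<and> \<not> phiI3 G"
  using realize_bull_on[of "{..4}" "\<lambda>a b c. \<not> a \<and> \<not> b \<and> \<not> c"] not_no_dominating_clique_bull_on
    not_maximal_cliques_dominate_bull_on not_dominating_cliques_maximal_bull_on by simp_all

lemma realize_phi2_phi3:
  "\<exists>G. is_graph G \<and> ext_prop s G \<and> phiC2 G \<and> phiC3 G"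
  "\<exists>G. is_graph G \<and> ext_prop s G \<and> phiI2 G \<and> phiI3 G"
  using realize_bull_on[of "{1, 2}" "\<lambda>a b c. b \<and> c"] maximal_cliques_dominate_bull_on
    dominating_cliques_maximal_bull_on by simp_all

lemma realize_phi2_not_phi3:
  "\<exists>G. is_graph G \<and> ext_prop s G \<and> phiC2 G \<and> \<not> phiC3 G"
  "\<exists>G. is_graph G \<and> ext_prop s G \<and> phiI2 G \<and> \<not> phiI3 G"
  using realize_bull_on[of "{1, 2, 4}" "\<lambda>a b c. b \<and> \<not> c"] maximal_cliques_dominate_bull_on
    not_dominating_cliques_maximal_bull_on by simp_all

theorem theorem4:
  shows "(\<exists>s::nat. 0 < s \<and>
            (\<forall>G H. is_graph G \<longrightarrow> is_graph H \<longrightarrow> ext_prop s G \<longrightarrow> ext_prop s H \<longrightarrow>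
               (phiC1 G \<longleftrightarrow> phiC1 H) \<longrightarrow> (phiC2 G \<longleftrightarrow> phiC2 H) \<longrightarrow> (phiC3 G \<longleftrightarrow> phiC3 H) \<longrightarrow>
               (phiI1 G \<longleftrightarrow> phiI1 H) \<longrightarrow> (phiI2 G \<longleftrightarrow> phiI2 H) \<longrightarrow> (phiI3 G \<longleftrightarrow> phiI3 H) \<longrightarrow>
               (\<forall>\<phi>. E12 \<phi> \<longrightarrow> (holds_E12 G \<phi> \<longleftrightarrow> holds_E12 H \<phi>))))
       \<and> (\<forall>s::nat. 0 < s \<longrightarrow>
            (\<forall>\<phi> \<in> {phiC1,
                    \<lambda>G. \<not> phiC1 G \<and> \<not> phiC2 G \<and> phiC3 G,
                    \<lambda>G. \<not> phiC1 G \<and> \<not> phiC2 G \<and> \<not> phiC3 G,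
                    \<lambda>G. phiC2 G \<and> phiC3 G,
                    \<lambda>G. phiC2 G \<and> \<not> phiC3 G}.
               \<exists>G. is_graph G \<and> ext_prop s G \<and> \<phi> G)
          \<and> (\<forall>\<phi> \<in> {phiI1,
                    \<lambda>G. \<not> phiI1 G \<and> \<not> phiI2 G \<and> phiI3 G,
                    \<lambda>G. \<not> phiI1 G \<and> \<not> phiI2 G \<and> \<not> phiI3 G,
                    \<lambda>G. phiI2 G \<and> phiI3 G,
                    \<lambda>G. phiI2 G \<and> \<not> phiI3 G}.
               \<exists>G. is_graph G \<and> ext_prop s G \<and> \<phi> G))"
proof (intro conjI exI[of _ 6] allI impI)
  fix G H \<phi>
  assume "is_graph G" "is_graph H" "ext_prop 6 G" "ext_prop 6 H"
    and same: "phiC1 G \<longleftrightarrow> phiC1 H" "phiC2 G \<longleftrightarrow> phiC2 H" "phiC3 G \<longleftrightarrow> phiC3 H"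
      "phiI1 G \<longleftrightarrow> phiI1 H" "phiI2 G \<longleftrightarrow> phiI2 H" "phiI3 G \<longleftrightarrow> phiI3 H"
    and "E12 \<phi>"
  then have "ext_graph G 6" "ext_graph H 6" by (simp_all add: ext_graph_def)
  then show "holds_E12 G \<phi> \<longleftrightarrow> holds_E12 H \<phi>"
    using holds_E12_cong_if_same_sentences[OF _ _ order_refl \<open>E12 \<phi>\<close> same] by blast
qed (simp_all add: realize_phi1 realize_only_phi3 realize_no_phi realize_phi2_phi3 realize_phi2_not_phi3)

end
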